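(* (i) Let $T_n^U$ be the size of a uniform tree of the Moran forest $\mathscr{F}_n$ (a tree sampled uniformly at random among the trees composing $\mathscr{F}_n$). Then, for every integer $k\ge 1$, \[ \mathbb{P}(T_n^U = k) \xrightarrow[n\to\infty]{} 2\int_0^1 x e^{-x}(1-e^{-x})^{k-1}\,dx, \] that is, $T_n^U$ converges in distribution to $T^U$, where $T^U\sim\mathrm{Geometric}(e^{-X})$ and $X$ has density $2x\,dx$ on $[0,1]$. (ii) Let $T_n^{(1)}$ be the size of the tree containing vertex $1$ in $\mathscr{F}_n$. Then, for every integer $k\ge 1$, \[ \mathbb{P}(T_n^{(1)} = k) \xrightarrow[n\to\infty]{} k\int_0^1 x e^{-x}(1-e^{-x})^{k-1}\,dx, \] that is, $T_n^{(1)}$ converges in distribution to the size-biasing of $T^U$.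
   Context: Moran forest: for fixed $n\ge 2$, consider the Markov chain on directed graphs on $\{1,\ldots,n\}$ whose transitions are: at each time-step, choose an ordered pair of distinct vertices $(u,v)$ uniformly at random; disconnect $v$ from all of its neighbors (remove all edges incident to $v$), then add the edge $\vec{uv}$. This chain has a unique stationary distribution, whose support is the set of non-empty rooted forests (those with at least one edge) on $\{1,\ldots,n\}$. The Moran forest $\mathscr{F}_n$ is a random forest having this stationary distribution. The trees of the forest are its connected components (isolated vertices count as trees of size 1); the size of a tree is its number of vertices. $\mathrm{Geometric}(p)$ is the distribution on $\{1,2,\ldots\}$ with $\mathbb{P}(k)=p(1-p)^{k-1}$; $T^U\sim \mathrm{Geometric}(e^{-X})$ means that conditionally on $X$ the variable $T^U$ is geometric with parameter $e^{-X}$. The size-biasing of a positive-integer-valued variable $T$ with finite mean is the law $k\mapsto k\,\mathbb{P}(T=k)/\mathbb{E}[T]$. *)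

theory Defs
  imports "HOL-Probability.Probability"
begin

definition vertex_pairs :: "nat \<Rightarrow> (nat \<times> nat) set" where
  "vertex_pairs n = {(u, v). u \<in> {1..n} \<and> v \<in> {1..n} \<and> u \<noteq> v}"

text \<open>A directed graph on \<open>{1..n}\<close> is represented by its set of edges, \<open>(u, v)\<close> being the
  edge from \<open>u\<close> to \<open>v\<close>.\<close>

definition digraphs :: "nat \<Rightarrow> (nat \<times> nat) set set" where
  "digraphs n = Pow (vertex_pairs n)"

definition moran_update :: "nat \<times> nat \<Rightarrow> (nat \<times> nat) set \<Rightarrow> (nat \<times> nat) set" where
  "moran_update e G = insert e {(a, b) \<in> G. a \<noteq> snd e \<and> b \<noteq> snd e}"

definition moran_step :: "nat \<Rightarrow> (nat \<times> nat) set \<Rightarrow> (nat \<times> nat) set pmf" where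
  "moran_step n G = map_pmf (\<lambda>e. moran_update e G) (pmf_of_set (vertex_pairs n))"

definition moran_stationary :: "nat \<Rightarrow> (nat \<times> nat) set pmf \<Rightarrow> bool" where
  "moran_stationary n \<mu> \<longleftrightarrow> set_pmf \<mu> \<subseteq> digraphs n \<and> bind_pmf \<mu> (moran_step n) = \<mu>"

text \<open>The description is proper for \<open>n \<ge> 2\<close>, see \<open>ex1_moran_stationary\<close> below.\<close>

definition moran_forest :: "nat \<Rightarrow> (nat \<times> nat) set pmf" where
  "moran_forest n = (THE \<mu>. moran_stationary n \<mu>)"

text \<open>The trees are the connected components, edge directions being ignored; each of them is
  represented by its set of vertices.\<close>

definition connected_rel :: "nat \<Rightarrow> (nat \<times> nat) set \<Rightarrow> (nat \<times> nat) set" where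
  "connected_rel n G = {(a, b). a \<in> {1..n} \<and> b \<in> {1..n} \<and> (a, b) \<in> (G \<union> G\<inverse>)\<^sup>*}"

definition trees :: "nat \<Rightarrow> (nat \<times> nat) set \<Rightarrow> nat set set" where
  "trees n G = {1..n} // connected_rel n G"

definition tree_of :: "nat \<Rightarrow> (nat \<times> nat) set \<Rightarrow> nat \<Rightarrow> nat set" where
  "tree_of n G v = connected_rel n G `` {v}"

definition uniform_tree_size :: "nat \<Rightarrow> nat pmf" where
  "uniform_tree_size n =
     bind_pmf (moran_forest n) (\<lambda>G. map_pmf card (pmf_of_set (trees n G)))"

definition vertex1_tree_size :: "nat \<Rightarrow> nat pmf" where
  "vertex1_tree_size n = map_pmf (\<lambda>G. card (tree_of n G 1)) (moran_forest n)"

text \<open>The law of \<open>X\<close>, and the law of \<open>T\<^sup>U\<close>: a mixture over \<open>X\<close> of geometric laws on the positive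
  integers (the library's \<open>geometric_pmf\<close> lives on \<open>{0, 1, \<dots>}\<close>, hence \<open>Suc\<close>).\<close>

definition X_law :: "real measure" where
  "X_law = density (restrict_space lborel {0..1}) (\<lambda>x. ennreal (2 * x))"

definition TU_law :: "nat measure" where
  "TU_law = X_law \<bind> (\<lambda>x. measure_pmf (map_pmf Suc (geometric_pmf (exp (- x)))))"

definition size_biased :: "nat measure \<Rightarrow> nat measure" where
  "size_biased M =
     density (count_space UNIV) (\<lambda>k. ennreal (real k * measure M {k} / (LINT j|M. real j)))"

definition conv_in_distribution :: "(nat \<Rightarrow> nat measure) \<Rightarrow> nat measure \<Rightarrow> bool" where
  "conv_in_distribution M N \<longleftrightarrow>
     weak_conv_m (\<lambda>n. distr (M n) borel real) (distr N borel real)"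


subsection \<open>Existence and uniqueness of the stationary distribution\<close>

lemma finite_vertex_pairs [simp]: "finite (vertex_pairs n)"
proof -
  have "vertex_pairs n \<subseteq> {1..n} \<times> {1..n}" by (auto simp: vertex_pairs_def)
  then show ?thesis by (rule finite_subset) auto
qed

lemma finite_digraphs [simp]: "finite (digraphs n)"
  by (simp add: digraphs_def)

lemma vertex_pairs_nonempty: "n \<ge> 2 \<Longrightarrow> vertex_pairs n \<noteq> {}"
proof -
  assume "n \<ge> 2"
  then have "(1, 2) \<in> vertex_pairs n" by (auto simp: vertex_pairs_def)
  then show ?thesis by blast
qed

lemma moran_update_digraphs:
  "e \<in> vertex_pairs n \<Longrightarrow> G \<in> digraphs n \<Longrightarrow> moran_update e G \<in> digraphs n"
  by (auto simp: moran_update_def digraphs_def)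

lemma set_moran_step:
  "n \<ge> 2 \<Longrightarrow> G \<in> digraphs n \<Longrightarrow> set_pmf (moran_step n G) \<subseteq> digraphs n"
  by (auto simp: moran_step_def set_pmf_of_set vertex_pairs_nonempty intro: moran_update_digraphs)

lemma sum_card_Diff_vertex_pairs:
  assumes "n \<ge> 2" "A \<subseteq> {1..n}"
  shows "(\<Sum>e\<in>vertex_pairs n. real (card (A - {snd e}))) / real (card (vertex_pairs n))
         = real (card A) * (1 - 1 / real n)"
proof -
  have fA: "finite A" using assms(2) finite_subset by blast
  have vp: "vertex_pairs n = (\<lambda>(v,u). (u,v)) ` (SIGMA v:{1..n}. {1..n} - {v})"
    by (auto simp: vertex_pairs_def image_iff)
  have inj: "inj_on (\<lambda>(v,u). (u,v)) (SIGMA v:{1..n}. {1..n} - {v})"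
    by (auto simp: inj_on_def)
  have sm: "(\<Sum>e\<in>vertex_pairs n. f (snd e)) = real (n - 1) * (\<Sum>v=1..n. f v)" for f :: "nat \<Rightarrow> real"
  proof -
    have "(\<Sum>e\<in>vertex_pairs n. f (snd e)) = (\<Sum>(v,u)\<in>(SIGMA v:{1..n}. {1..n} - {v}). f v)"
      unfolding vp by (subst sum.reindex[OF inj]) (auto intro!: sum.cong)
    also have "\<dots> = (\<Sum>v=1..n. \<Sum>u\<in>{1..n} - {v}. f v)"
      by (subst sum.Sigma) auto
    also have "\<dots> = (\<Sum>v=1..n. real (n - 1) * f v)"
      by (intro sum.cong) (auto simp: card_Diff_singleton)
    finally show ?thesis by (simp add: sum_distrib_left)
  qed
  have c: "real (card (vertex_pairs n)) = real (n - 1) * real n"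
    using sm[of "\<lambda>_. 1"] by simp
  have "real (card (A - {v})) = real (card A) - indicator A v" for v
  proof (cases "v \<in> A")
    case True
    then have "card A \<ge> 1" using fA by (auto simp: Suc_le_eq card_gt_0_iff)
    then show ?thesis using True by (simp add: card_Diff_singleton of_nat_diff)
  qed simp
  then have "(\<Sum>v=1..n. real (card (A - {v}))) = real n * real (card A) - (\<Sum>v=1..n. indicator A v)"
    by (simp add: sum_subtractf)
  also have "(\<Sum>v=1..n. indicator A v) = real (card A)"
    using assms(2) by (simp add: indicator_def sum.If_cases Int_absorb1 del: One_nat_def)
  finally have S: "(\<Sum>v=1..n. real (card (A - {v}))) = real (card A) * (real n - 1)"
    by (simp add: algebra_simps)
  have "real (n - 1) \<noteq> 0" "real n \<noteq> 0" using assms(1) by auto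
  then show ?thesis
    unfolding sm[of "\<lambda>v. real (card (A - {v}))"] c S by (simp add: divide_simps)
qed

primrec moran_iter :: "nat \<Rightarrow> nat \<Rightarrow> (nat \<times> nat) set \<Rightarrow> (nat \<times> nat) set pmf" where
  "moran_iter n 0 = return_pmf"
| "moran_iter n (Suc m) = (\<lambda>G. bind_pmf (moran_step n G) (moran_iter n m))"

lemma moran_iter_add:
  "moran_iter n (m + k) G = bind_pmf (moran_iter n m G) (moran_iter n k)"
proof (induction m arbitrary: G)
  case (Suc m)
  then have "moran_iter n (m + k) = (\<lambda>G. bind_pmf (moran_iter n m G) (moran_iter n k))" by blast
  then show ?case by (simp add: bind_assoc_pmf)
qed (simp add: bind_return_pmf)

lemma set_moran_iter:
  "n \<ge> 2 \<Longrightarrow> G \<in> digraphs n \<Longrightarrow> set_pmf (moran_iter n m G) \<subseteq> digraphs n"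
proof (induction m arbitrary: G)
  case (Suc m)
  then show ?case using set_moran_step[of n G] by fastforce
qed simp

text \<open>Two copies of the chain driven by the same pairs can differ only by edges between vertices
  that have not been disconnected yet.\<close>

lemma moran_iter_contract:
  assumes n: "n \<ge> 2" and "A \<subseteq> {1..n}"
    and "\<And>a b. a \<notin> A \<or> b \<notin> A \<Longrightarrow> (a, b) \<in> G \<longleftrightarrow> (a, b) \<in> H"
  shows "\<bar>pmf (moran_iter n m G) y - pmf (moran_iter n m H) y\<bar> \<le> real (card A) * (1 - 1 / real n) ^ m"
  using assms(2,3)
proof (induction m arbitrary: A G H)
  case 0
  show ?case
  proof (cases "A = {}")
    case True
    then have "G = H" using 0 by auto
    then show ?thesis by simp
  next
    case False
    then have "card A \<ge> 1" using 0 finite_subset[of A] by (simp add: Suc_le_eq card_gt_0_iff)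
    then have "1 \<le> real (card A)" by simp
    moreover have "\<bar>pmf (moran_iter n 0 G) y - pmf (moran_iter n 0 H) y\<bar> \<le> 1"
      by (simp add: indicator_def)
    ultimately show ?thesis by simp
  qed
next
  case (Suc m)
  let ?V = "vertex_pairs n"
  let ?q = "(1 - 1 / real n) ^ m"
  have V: "?V \<noteq> {}" "finite ?V" using n vertex_pairs_nonempty by auto
  have exp: "pmf (moran_iter n (Suc m) K) y
      = (\<Sum>e\<in>?V. pmf (moran_iter n m (moran_update e K)) y) / real (card ?V)" for K
    using V by (simp add: moran_step_def bind_map_pmf pmf_bind integral_pmf_of_set)
  have "\<bar>pmf (moran_iter n (Suc m) G) y - pmf (moran_iter n (Suc m) H) y\<bar>
     = \<bar>\<Sum>e\<in>?V. pmf (moran_iter n m (moran_update e G)) y - pmf (moran_iter n m (moran_update e H)) y\<bar>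
        / real (card ?V)"
    by (simp only: exp sum_subtractf diff_divide_distrib[symmetric] abs_divide abs_of_nat)
  also have "\<dots> \<le> (\<Sum>e\<in>?V. real (card (A - {snd e})) * ?q) / real (card ?V)"
  proof (intro divide_right_mono order.trans[OF sum_abs] sum_mono)
    fix e assume "e \<in> ?V"
    show "\<bar>pmf (moran_iter n m (moran_update e G)) y - pmf (moran_iter n m (moran_update e H)) y\<bar>
       \<le> real (card (A - {snd e})) * ?q"
    proof (rule Suc.IH)
      show "A - {snd e} \<subseteq> {1..n}" using Suc.prems by auto
      show "(a, b) \<in> moran_update e G \<longleftrightarrow> (a, b) \<in> moran_update e H"
        if "a \<notin> A - {snd e} \<or> b \<notin> A - {snd e}" for a b
        using that Suc.prems(2)[of a b] by (auto simp: moran_update_def)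
    qed
  qed auto
  also have "\<dots> = (\<Sum>e\<in>?V. real (card (A - {snd e}))) / real (card ?V) * ?q"
    by (simp add: sum_distrib_right)
  also have "\<dots> = real (card A) * (1 - 1 / real n) ^ Suc m"
    using sum_card_Diff_vertex_pairs[OF n Suc.prems(1)] by simp
  finally show ?case .
qed

lemma pmf_bind_moran_iter:
  assumes n: "n \<ge> 2" and \<mu>: "set_pmf \<mu> \<subseteq> digraphs n" and H: "H \<in> digraphs n"
  shows "\<bar>pmf (bind_pmf \<mu> (moran_iter n m)) y - pmf (moran_iter n m H) y\<bar>
         \<le> real n * (1 - 1 / real n) ^ m"
proof -
  let ?P = "\<lambda>G. pmf (moran_iter n m G) y"
  have S: "(\<Sum>G\<in>digraphs n. pmf \<mu> G) = 1" using \<mu> by (simp add: sum_pmf_eq_1)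
  have "pmf (bind_pmf \<mu> (moran_iter n m)) y = (\<Sum>G\<in>digraphs n. ?P G * pmf \<mu> G)"
    unfolding pmf_bind using \<mu> by (intro integral_measure_pmf_real) auto
  then have "pmf (bind_pmf \<mu> (moran_iter n m)) y - ?P H = (\<Sum>G\<in>digraphs n. (?P G - ?P H) * pmf \<mu> G)"
    by (simp add: left_diff_distrib sum_subtractf S flip: sum_distrib_left)
  also have "\<bar>\<dots>\<bar> \<le> (\<Sum>G\<in>digraphs n. real n * (1 - 1 / real n) ^ m * pmf \<mu> G)"
  proof (intro order.trans[OF sum_abs] sum_mono)
    fix G assume "G \<in> digraphs n"
    then have "\<bar>?P G - ?P H\<bar> \<le> real (card {1..n}) * (1 - 1 / real n) ^ m"
      using H by (intro moran_iter_contract[OF n]) (auto simp: digraphs_def vertex_pairs_def)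
    then show "\<bar>(?P G - ?P H) * pmf \<mu> G\<bar> \<le> real n * (1 - 1 / real n) ^ m * pmf \<mu> G"
      by (simp add: abs_mult mult_right_mono)
  qed
  finally show ?thesis by (simp add: S flip: sum_distrib_left)
qed

lemma moran_rate_tendsto_0:
  assumes "n \<ge> 2"
  shows "(\<lambda>m. real n * (1 - 1 / real n) ^ m) \<longlonglongrightarrow> 0"
proof -
  have "(\<lambda>m. (1 - 1 / real n) ^ m) \<longlonglongrightarrow> 0"
    using assms by (intro LIMSEQ_realpow_zero) auto
  then show ?thesis by (rule tendsto_mult_right_zero)
qed

lemma moran_stationary_iter:
  assumes "moran_stationary n \<mu>"
  shows "bind_pmf \<mu> (moran_iter n m) = \<mu>"
proof (induction m)
  case 0
  show ?case by (simp add: bind_return_pmf')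
next
  case (Suc m)
  then show ?case using assms by (simp add: moran_stationary_def flip: bind_assoc_pmf)
qed

lemma moran_stationary_limit:
  assumes n: "n \<ge> 2" and \<mu>: "moran_stationary n \<mu>" and H: "H \<in> digraphs n"
  shows "(\<lambda>m. pmf (moran_iter n m H) y) \<longlonglongrightarrow> pmf \<mu> y"
proof (rule LIMSEQ_I)
  fix r :: real assume "0 < r"
  then obtain N where N: "\<And>m. m \<ge> N \<Longrightarrow> \<bar>real n * (1 - 1 / real n) ^ m\<bar> < r"
    using LIMSEQ_D[OF moran_rate_tendsto_0[OF n]] by auto
  have "norm (pmf (moran_iter n m H) y - pmf \<mu> y) < r" if "m \<ge> N" for m
    using N[OF that] pmf_bind_moran_iter[OF n _ H, of \<mu> m y] \<mu>
    by (simp add: moran_stationary_iter moran_stationary_def abs_minus_commute)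
  then show "\<exists>N. \<forall>m\<ge>N. norm (pmf (moran_iter n m H) y - pmf \<mu> y) < r" by blast
qed

theorem ex1_moran_stationary:
  assumes n: "n \<ge> 2"
  shows "\<exists>!\<mu>. moran_stationary n \<mu>"
proof (rule ex_ex1I)
  fix \<mu> \<nu> assume "moran_stationary n \<mu>" "moran_stationary n \<nu>"
  then show "\<mu> = \<nu>"
    using moran_stationary_limit[OF n, of _ "{}"]
    by (intro pmf_eqI) (auto simp: digraphs_def intro: LIMSEQ_unique)
next
  define p where "p m y = pmf (moran_iter n m {}) y" for m y
  have D: "{} \<in> digraphs n" by (simp add: digraphs_def)
  have supp: "set_pmf (moran_iter n m {}) \<subseteq> digraphs n" for m
    by (rule set_moran_iter[OF n D])
  have step: "\<bar>p (m + k) y - p m y\<bar> \<le> real n * (1 - 1 / real n) ^ m" for m k y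
    using pmf_bind_moran_iter[OF n supp D, of k m y]
    by (simp add: p_def add.commute flip: moran_iter_add)
  have "Cauchy (\<lambda>m. p m y)" for y
  proof (rule metric_CauchyI)
    fix r :: real assume r: "0 < r"
    then obtain N where N: "\<bar>real n * (1 - 1 / real n) ^ N\<bar> < r / 2"
      using LIMSEQ_D[OF moran_rate_tendsto_0[OF n], of "r / 2"] by auto
    have "\<bar>p m y - p N y\<bar> < r / 2" if "m \<ge> N" for m
      using step[of N "m - N" y] N that by simp
    then have "dist (p m y) (p m' y) < r" if "m \<ge> N" "m' \<ge> N" for m m'
      using that by (smt (verit) dist_real_def field_sum_of_halves)
    then show "\<exists>N. \<forall>m\<ge>N. \<forall>m'\<ge>N. dist (p m y) (p m' y) < r" by blast
  qed
  then have "\<exists>L. (\<lambda>m. p m y) \<longlonglongrightarrow> L" for y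
    using Cauchy_convergent convergent_def by blast
  then obtain L where L: "\<And>y. (\<lambda>m. p m y) \<longlonglongrightarrow> L y" by metis
  have L_ge: "L y \<ge> 0" for y
    by (rule LIMSEQ_le_const[OF L]) (auto simp: p_def)
  have L_out: "L y = 0" if "y \<notin> digraphs n" for y
  proof -
    have "p m y = 0" for m using supp[of m] that by (auto simp: p_def set_pmf_iff)
    then show ?thesis using LIMSEQ_unique[OF L[of y]] by simp
  qed
  have "(\<lambda>m. \<Sum>y\<in>digraphs n. p m y) \<longlonglongrightarrow> (\<Sum>y\<in>digraphs n. L y)"
    by (intro tendsto_sum L)
  moreover have "(\<Sum>y\<in>digraphs n. p m y) = 1" for m
    unfolding p_def using supp by (simp add: sum_pmf_eq_1)
  ultimately have L_sum: "(\<Sum>y\<in>digraphs n. L y) = 1"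
    by (simp add: LIMSEQ_const_iff)
  have "(\<integral>\<^sup>+ y. ennreal (L y) \<partial>count_space UNIV) = (\<Sum>y\<in>digraphs n. ennreal (L y))"
    using L_out by (intro nn_integral_count_space') auto
  also have "\<dots> = 1" by (simp add: sum_ennreal L_ge L_sum)
  finally have L_int: "(\<integral>\<^sup>+ y. ennreal (L y) \<partial>count_space UNIV) = 1" .
  define \<pi> where "\<pi> = embed_pmf L"
  have \<pi>: "pmf \<pi> y = L y" for y
    unfolding \<pi>_def by (rule pmf_embed_pmf[OF L_ge L_int])
  have supp\<pi>: "set_pmf \<pi> \<subseteq> digraphs n" using L_out by (force simp: set_pmf_iff \<pi>)
  have bnd: "pmf (bind_pmf \<mu> (moran_step n)) y = (\<Sum>G\<in>digraphs n. pmf (moran_step n G) y * pmf \<mu> G)"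
    if "set_pmf \<mu> \<subseteq> digraphs n" for \<mu> y
    unfolding pmf_bind using that by (intro integral_measure_pmf_real) auto
  have "bind_pmf \<pi> (moran_step n) = \<pi>"
  proof (rule pmf_eqI)
    fix y
    have one: "moran_iter n 1 = moran_step n" by (auto simp: bind_return_pmf' One_nat_def)
    have "p (m + 1) y = (\<Sum>G\<in>digraphs n. pmf (moran_step n G) y * p m G)" for m
      using bnd[OF supp] moran_iter_add[of n m 1 "{}"] by (simp only: p_def one)
    moreover have "(\<lambda>m. \<Sum>G\<in>digraphs n. pmf (moran_step n G) y * p m G)
        \<longlonglongrightarrow> (\<Sum>G\<in>digraphs n. pmf (moran_step n G) y * L G)"
      by (intro tendsto_intros L)
    ultimately have "(\<lambda>m. p (m + 1) y) \<longlonglongrightarrow> pmf (bind_pmf \<pi> (moran_step n)) y"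
      by (simp add: bnd[OF supp\<pi>] \<pi>)
    moreover have "(\<lambda>m. p (m + 1) y) \<longlonglongrightarrow> L y" by (rule LIMSEQ_ignore_initial_segment[OF L])
    ultimately show "pmf (bind_pmf \<pi> (moran_step n)) y = pmf \<pi> y"
      using LIMSEQ_unique \<pi> by metis
  qed
  then show "\<exists>\<mu>. moran_stationary n \<mu>" using supp\<pi> by (auto simp: moran_stationary_def)
qed

end

theory Submission
  imports Defs "HOL-Real_Asymp.Real_Asymp"
begin

text \<open>Run the stationary chain backwards in time and list the vertices in the order in which they are met
as second coordinate of a chosen pair. This order is uniform, and the partner \<open>u\<close> that is chosen
when \<open>v\<close> is met for the first time is uniform on the other vertices. The edge from \<open>u\<close> to \<open>v\<close> is
still present exactly if \<open>u\<close> has not been met before \<open>v\<close>. Reading the order from its oldest vertex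
on, the Moran forest is therefore a random recursive forest: each new vertex picks a uniform partner
among the \<open>N = n - 1\<close> other vertices, is attached to it if it is already there, and starts a new tree
otherwise. This law is \<open>grown_forest\<close>; that it is the stationary one is verified by
following it through one step of the chain (\<open>moran_stationary_grown_forest\<close>).

When \<open>j\<close> vertices are there, the next one starts a new tree with probability \<open>1 - j/N\<close> and joins a
given tree of size \<open>s\<close> with probability \<open>s/N\<close>. The latter is the dynamics of a discrete Yule process,
whose size after \<open>m\<close> steps has the explicit law \<open>yule N m\<close>. A vertex that is followed by \<open>m\<close> others
starts a new tree with probability \<open>m/N\<close>, and the final size of such a tree has law \<open>yule N m\<close>.
So the expected number of trees of size \<open>k\<close> is the sum of \<open>m/N * yule N m k\<close> over \<open>m < n\<close>
(\<open>expectation_size_moran_forest\<close>). With \<open>x = m/N\<close> the law \<open>yule N m\<close> approaches the geometric law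
with parameter \<open>exp (- x)\<close>, and the sum divided by \<open>N\<close> approaches the integral of
\<open>x exp (- x) (1 - exp (- x)) ^ (k - 1)\<close> over the unit interval, called \<open>mixture k\<close> below
(\<open>tendsto_yule_sum\<close>).

Since relabelling the vertices commutes with the chain, all vertices have the same law of tree size,
and the probability that the tree of vertex 1 has size \<open>k\<close> is \<open>k/n\<close> times the expected number of
trees of size \<open>k\<close>. For a uniform tree one has to divide by the number of trees inside the expectation.
That number has mean \<open>n/2\<close> and variance at most \<open>n/4\<close> (\<open>second_moment_card_trees\<close>), so replacing it
by \<open>n/2\<close> costs at most \<open>1 / sqrt n\<close> (\<open>uniform_tree_size_approx\<close>); this is the origin of the
factor 2. Finally, for laws on the naturals convergence of all point masses to those of the limit law
gives convergence in distribution, and the size-biasing has the right normalisation because the limit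
law has mean 2.\<close>

section \<open>The stationary law\<close>

definition isolate :: "nat \<Rightarrow> (nat \<times> nat) set \<Rightarrow> (nat \<times> nat) set" where
  "isolate v G = {(a, b) \<in> G. a \<noteq> v \<and> b \<noteq> v}"

text \<open>The list has the most recently disconnected vertex at its head. The partner of \<open>v\<close> is drawn among
all other vertices, also those that are not in the tail: drawing one of them means that the edge to
\<open>v\<close> has been removed since.\<close>

primrec grow :: "nat \<Rightarrow> nat list \<Rightarrow> (nat \<times> nat) set pmf" where
  "grow n [] = return_pmf {}"
| "grow n (v # xs) = bind_pmf (grow n xs)
     (\<lambda>G. map_pmf (\<lambda>u. if u \<in> set xs then insert (u, v) G else G) (pmf_of_set ({1..n} - {v})))"

text \<open>Disconnecting \<open>v\<close> has the same effect as never having inserted it: a vertex that picked \<open>v\<close> as its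
partner loses its edge, just as a vertex whose partner is not in the list has none.\<close>

lemma map_isolate_grow:
  "map_pmf (isolate v) (grow n xs) = grow n (filter (\<lambda>w. w \<noteq> v) xs)"
proof (induction xs)
  case Nil
  show ?case by (simp add: isolate_def)
next
  case (Cons w ys)
  let ?fs = "filter (\<lambda>w. w \<noteq> v) ys"
  let ?U = "pmf_of_set ({1..n} - {w})"
  have "map_pmf (isolate v) (grow n (w # ys)) =
      bind_pmf (grow n ys)
        (\<lambda>G. map_pmf (\<lambda>u. isolate v (if u \<in> set ys then insert (u, w) G else G)) ?U)"
    by (simp add: map_bind_pmf pmf.map_comp o_def)
  also have "\<dots> = grow n (filter (\<lambda>w. w \<noteq> v) (w # ys))"
  proof (cases "w = v")
    case True
    have "isolate v (if u \<in> set ys then insert (u, w) G else G) = isolate v G" for u G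
      using True by (auto simp: isolate_def)
    then show ?thesis using Cons.IH True by (simp add: map_pmf_def[symmetric])
  next
    case False
    have "isolate v (if u \<in> set ys then insert (u, w) G else G) =
        (if u \<in> set ?fs then insert (u, w) (isolate v G) else isolate v G)" for u G
      using False by (auto simp: isolate_def)
    then have "bind_pmf (grow n ys)
        (\<lambda>G. map_pmf (\<lambda>u. isolate v (if u \<in> set ys then insert (u, w) G else G)) ?U) =
      bind_pmf (map_pmf (isolate v) (grow n ys))
        (\<lambda>G. map_pmf (\<lambda>u. if u \<in> set ?fs then insert (u, w) G else G) ?U)"
      by (simp only: bind_map_pmf)
    then show ?thesis using Cons.IH False by simp
  qed
  finally show ?case .
qed

text \<open>A transition first picks the vertex to disconnect and then its new neighbour.\<close>

lemma pmf_of_set_vertex_pairs: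
  assumes n: "n \<ge> 2"
  shows "pmf_of_set (vertex_pairs n) =
    bind_pmf (pmf_of_set {1..n}) (\<lambda>v. map_pmf (\<lambda>u. (u, v)) (pmf_of_set ({1..n} - {v})))"
proof -
  let ?f = "\<lambda>v. (\<lambda>u. (u, v)) ` ({1..n} - {v})"
  have ne: "{1..n} - {v} \<noteq> {}" for v
  proof
    assume "{1..n} - {v} = {}"
    then have "{1..n} \<subseteq> {v}" by blast
    moreover have "1 \<in> {1..n}" "2 \<in> {1..n}" using n by auto
    ultimately have "1 \<in> {v}" "2 \<in> {v}" by blast+
    then show False by simp
  qed
  have "vertex_pairs n = \<Union>(?f ` {1..n})" by (auto simp: vertex_pairs_def)
  also have "pmf_of_set \<dots> = bind_pmf (pmf_of_set {1..n}) (\<lambda>v. pmf_of_set (?f v))"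
  proof (rule pmf_of_set_UN)
    show "card (?f v) = n - 1" if "v \<in> {1..n}" for v
      using that by (subst card_image) (auto simp: inj_on_def)
    show "?f v \<noteq> {}" for v using ne[of v] by simp
  qed (use n in \<open>auto simp: disjoint_family_on_def\<close>)
  also have "\<dots> = bind_pmf (pmf_of_set {1..n}) (\<lambda>v. map_pmf (\<lambda>u. (u, v)) (pmf_of_set ({1..n} - {v})))"
    using ne by (intro bind_pmf_cong refl map_pmf_of_set_inj[symmetric]) (auto simp: inj_on_def)
  finally show ?thesis .
qed

text \<open>With one element removed, a uniform order is still uniform; hence moving a uniform vertex to the
front preserves the uniform law on orders.\<close>

lemma map_filter_random_permutation:
  assumes "finite A"
  shows "map_pmf (filter P) (pmf_of_set (permutations_of_set A)) =
    pmf_of_set (permutations_of_set {x \<in> A. P x})"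
proof -
  have "map_pmf (filter P) (pmf_of_set (permutations_of_set A)) =
      map_pmf fst (map_pmf (partition P) (pmf_of_set (permutations_of_set A)))"
    by (simp add: pmf.map_comp o_def)
  also have "\<dots> = pmf_of_set (permutations_of_set {x \<in> A. P x})"
    using assms by (simp add: partition_random_permutations map_fst_pair_pmf)
  finally show ?thesis .
qed

definition grown_forest :: "nat \<Rightarrow> (nat \<times> nat) set pmf" where
  "grown_forest n = bind_pmf (pmf_of_set (permutations_of_set {1..n})) (grow n)"

lemma set_grow:
  assumes "G \<in> set_pmf (grow n xs)" "distinct xs"
  shows "G \<subseteq> set xs \<times> set xs" "\<And>a. (a, a) \<notin> G"
proof -
  have "G \<subseteq> set xs \<times> set xs \<and> (\<forall>a. (a, a) \<notin> G)"
    using assms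
  proof (induction xs arbitrary: G)
    case (Cons v xs)
    then obtain H u where "H \<in> set_pmf (grow n xs)" "G = (if u \<in> set xs then insert (u, v) H else H)"
      unfolding grow.simps set_bind_pmf set_map_pmf by blast
    moreover from this Cons have "H \<subseteq> set xs \<times> set xs" "\<forall>a. (a, a) \<notin> H" "v \<notin> set xs" by auto
    ultimately show ?case by auto
  qed simp
  then show "G \<subseteq> set xs \<times> set xs" "\<And>a. (a, a) \<notin> G" by auto
qed

lemma finite_set_grow:
  assumes "distinct xs"
  shows "finite (set_pmf (grow n xs))"
proof (rule finite_subset)
  show "set_pmf (grow n xs) \<subseteq> Pow (set xs \<times> set xs)"
    using set_grow(1)[OF _ assms] by blast
qed simp

text \<open>In one step a uniform vertex \<open>v\<close> is disconnected and joined to a uniform partner. By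
\<open>map_isolate_grow\<close> this turns the forest grown along \<open>xs\<close> into the one grown along the list in which
\<open>v\<close> has been moved to the front: all other vertices precede \<open>v\<close>, so that its edge is always kept. The
order stays uniform.\<close>

lemma moran_stationary_grown_forest:
  assumes n: "n \<ge> 2"
  shows "moran_stationary n (grown_forest n)"
  unfolding moran_stationary_def
proof
  let ?P = "\<lambda>A. pmf_of_set (permutations_of_set A)"
  let ?U = "\<lambda>v. pmf_of_set ({1..n} - {v})"
  show "set_pmf (grown_forest n) \<subseteq> digraphs n"
  proof
    fix G assume "G \<in> set_pmf (grown_forest n)"
    then obtain xs where "xs \<in> permutations_of_set {1..n}" "G \<in> set_pmf (grow n xs)"
      by (auto simp: grown_forest_def set_pmf_of_set)
    then show "G \<in> digraphs n"
      using set_grow[of G n xs]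
      by (auto simp: permutations_of_set_def digraphs_def vertex_pairs_def)
  qed
  have "bind_pmf (grown_forest n) (moran_step n) =
    bind_pmf (?P {1..n}) (\<lambda>xs. bind_pmf (grow n xs) (\<lambda>G. bind_pmf (pmf_of_set {1..n})
      (\<lambda>v. bind_pmf (?U v) (\<lambda>u. return_pmf (insert (u, v) (isolate v G))))))"
    unfolding grown_forest_def moran_step_def pmf_of_set_vertex_pairs[OF n]
    by (simp add: bind_assoc_pmf map_bind_pmf pmf.map_comp o_def moran_update_def isolate_def)
       (simp add: map_pmf_def)
  also have "\<dots> = bind_pmf (?P {1..n}) (\<lambda>xs. bind_pmf (pmf_of_set {1..n}) (\<lambda>v. bind_pmf (grow n xs)
      (\<lambda>G. bind_pmf (?U v) (\<lambda>u. return_pmf (insert (u, v) (isolate v G))))))"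
    by (subst bind_commute_pmf) (rule refl)
  also have "\<dots> = bind_pmf (pmf_of_set {1..n}) (\<lambda>v. bind_pmf (?P {1..n}) (\<lambda>xs. bind_pmf (grow n xs)
      (\<lambda>G. bind_pmf (?U v) (\<lambda>u. return_pmf (insert (u, v) (isolate v G))))))"
    by (subst bind_commute_pmf) (rule refl)
  also have "\<dots> = bind_pmf (pmf_of_set {1..n}) (\<lambda>v. bind_pmf (?P {1..n}) (\<lambda>xs.
      bind_pmf (map_pmf (isolate v) (grow n xs))
        (\<lambda>G. bind_pmf (?U v) (\<lambda>u. return_pmf (insert (u, v) G)))))"
    by (simp only: bind_map_pmf)
  also have "\<dots> = bind_pmf (pmf_of_set {1..n}) (\<lambda>v.
      bind_pmf (map_pmf (filter (\<lambda>w. w \<noteq> v)) (?P {1..n})) (\<lambda>xs. bind_pmf (grow n xs)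
        (\<lambda>G. bind_pmf (?U v) (\<lambda>u. return_pmf (insert (u, v) G)))))"
    by (simp only: map_isolate_grow bind_map_pmf)
  also have "\<dots> = bind_pmf (pmf_of_set {1..n}) (\<lambda>v.
      bind_pmf (?P ({1..n} - {v})) (\<lambda>xs. grow n (v # xs)))"
  proof (intro bind_pmf_cong refl)
    fix v assume v: "v \<in> set_pmf (pmf_of_set {1..n})"
    have "{x \<in> {1..n}. x \<noteq> v} = {1..n} - {v}" by auto
    then show "map_pmf (filter (\<lambda>w. w \<noteq> v)) (?P {1..n}) = ?P ({1..n} - {v})"
      by (simp add: map_filter_random_permutation)
    fix xs assume "xs \<in> set_pmf (?P ({1..n} - {v}))"
    then have "xs \<in> permutations_of_set ({1..n} - {v})" by (subst (asm) set_pmf_of_set) auto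
    then have xs: "set xs = {1..n} - {v}" by (simp add: permutations_of_set_def)
    have "\<exists>u. u \<in> {1..n} - {v}"
      by (rule exI[of _ "if v = 1 then 2 else 1"]) (use n in auto)
    then have "set_pmf (?U v) = set xs" using xs by (subst set_pmf_of_set) auto
    then show "bind_pmf (grow n xs) (\<lambda>G. bind_pmf (?U v) (\<lambda>u. return_pmf (insert (u, v) G))) =
        grow n (v # xs)"
      by (auto simp: map_pmf_def intro!: bind_pmf_cong)
  qed
  also have "\<dots> = bind_pmf (bind_pmf (pmf_of_set {1..n}) (\<lambda>v.
      bind_pmf (?P ({1..n} - {v})) (\<lambda>xs. return_pmf (v # xs)))) (grow n)"
    by (simp add: bind_assoc_pmf bind_return_pmf)
  also have "\<dots> = grown_forest n"
    unfolding grown_forest_def using n by (subst (2) random_permutation_of_set) auto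
  finally show "bind_pmf (grown_forest n) (moran_step n) = grown_forest n" .
qed

lemma moran_forest_eq_grown_forest:
  assumes "n \<ge> 2"
  shows "moran_forest n = grown_forest n"
  unfolding moran_forest_def
  using ex1_moran_stationary[OF assms] moran_stationary_grown_forest[OF assms]
  by (rule the1_equality)

definition relabel :: "(nat \<Rightarrow> nat) \<Rightarrow> (nat \<times> nat) set \<Rightarrow> (nat \<times> nat) set" where
  "relabel \<sigma> G = map_prod \<sigma> \<sigma> ` G"

text \<open>The relabelled law is stationary too, hence equal to the original one by uniqueness.\<close>

lemma map_relabel_moran_forest:
  assumes n: "n \<ge> 2" and \<sigma>: "bij_betw \<sigma> {1..n} {1..n}"
    and inj: "inj \<sigma>"
  shows "map_pmf (relabel \<sigma>) (moran_forest n) = moran_forest n"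
proof -
  let ?\<mu> = "moran_forest n"
  have st: "moran_stationary n ?\<mu>"
    using moran_forest_eq_grown_forest moran_stationary_grown_forest n by simp
  have img: "\<sigma> ` {1..n} = {1..n}" using \<sigma> by (simp add: bij_betw_def)
  have iff: "\<sigma> x \<in> {1..n} \<longleftrightarrow> x \<in> {1..n}" for x
    using img inj by (metis inj_image_mem_iff)
  have "map_prod \<sigma> \<sigma> (a, b) \<in> vertex_pairs n" if "(a, b) \<in> vertex_pairs n" for a b
    using that iff[of a] iff[of b] injD[OF inj, of a b] unfolding vertex_pairs_def by auto
  then have "map_prod \<sigma> \<sigma> ` vertex_pairs n \<subseteq> vertex_pairs n" by auto
  moreover have inj2: "inj (map_prod \<sigma> \<sigma>)" using inj by (rule prod.inj_map) (rule inj)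
  ultimately have vp: "map_prod \<sigma> \<sigma> ` vertex_pairs n = vertex_pairs n"
    by (intro endo_inj_surj) (auto intro: inj_on_subset)
  have pairs: "map_pmf (map_prod \<sigma> \<sigma>) (pmf_of_set (vertex_pairs n)) = pmf_of_set (vertex_pairs n)"
    using vp vertex_pairs_nonempty[OF n] inj_on_subset[OF inj2]
    by (subst map_pmf_of_set_inj) auto
  have upd: "relabel \<sigma> (moran_update e G) = moran_update (map_prod \<sigma> \<sigma> e) (relabel \<sigma> G)" for e G
    using inj by (cases e) (force simp: relabel_def moran_update_def inj_eq image_iff)
  have "bind_pmf (map_pmf (relabel \<sigma>) ?\<mu>) (moran_step n) =
      bind_pmf ?\<mu> (\<lambda>G. map_pmf (\<lambda>e. moran_update e (relabel \<sigma> G)) (pmf_of_set (vertex_pairs n)))"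
    by (simp add: bind_map_pmf moran_step_def)
  also have "\<dots> = bind_pmf ?\<mu> (\<lambda>G. map_pmf (\<lambda>e. moran_update e (relabel \<sigma> G))
      (map_pmf (map_prod \<sigma> \<sigma>) (pmf_of_set (vertex_pairs n))))"
    by (simp add: pairs)
  also have "\<dots> = map_pmf (relabel \<sigma>) (bind_pmf ?\<mu> (moran_step n))"
    by (simp add: map_bind_pmf moran_step_def pmf.map_comp o_def upd)
  also have "\<dots> = map_pmf (relabel \<sigma>) ?\<mu>" using st by (simp add: moran_stationary_def)
  finally have "bind_pmf (map_pmf (relabel \<sigma>) ?\<mu>) (moran_step n) = map_pmf (relabel \<sigma>) ?\<mu>" .
  moreover have "relabel \<sigma> G \<in> digraphs n" if "G \<in> digraphs n" for G
    using that image_mono[of G "vertex_pairs n" "map_prod \<sigma> \<sigma>"] vp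
    by (simp add: digraphs_def relabel_def)
  ultimately have "moran_stationary n (map_pmf (relabel \<sigma>) ?\<mu>)"
    using st by (auto simp: moran_stationary_def)
  then show ?thesis using ex1_moran_stationary[OF n] st by blast
qed

section \<open>Trees when a leaf is attached\<close>

lemma mem_tree_of:
  "b \<in> tree_of n G a \<longleftrightarrow> a \<in> {1..n} \<and> b \<in> {1..n} \<and> (a, b) \<in> (G \<union> G\<inverse>)\<^sup>*"
  by (auto simp: tree_of_def connected_rel_def)

lemma equiv_connected_rel: "equiv {1..n} (connected_rel n G)"
proof (rule equivI)
  have "sym ((G \<union> G\<inverse>)\<^sup>*)" by (simp add: sym_Un_converse sym_rtrancl)
  then show "sym (connected_rel n G)" unfolding connected_rel_def sym_def by blast
  show "trans (connected_rel n G)"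
    by (rule transI) (simp add: connected_rel_def, elim conjE, erule (1) rtrancl_trans)
  show "refl_on {1..n} (connected_rel n G)" by (simp add: connected_rel_def refl_on_def)
  show "connected_rel n G \<subseteq> {1..n} \<times> {1..n}" by (auto simp: connected_rel_def)
qed

lemma finite_tree_of [simp]: "finite (tree_of n G a)"
  by (rule finite_subset[of _ "{1..n}"]) (auto simp: mem_tree_of)

lemma self_in_tree_of: "a \<in> {1..n} \<Longrightarrow> a \<in> tree_of n G a"
  by (simp add: mem_tree_of)

lemma card_tree_of_pos: "a \<in> {1..n} \<Longrightarrow> card (tree_of n G a) > 0"
  using self_in_tree_of[of a n G] by (auto simp: card_gt_0_iff)

lemma tree_of_eq:
  "b \<in> tree_of n G a \<Longrightarrow> tree_of n G b = tree_of n G a"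
  using equiv_class_eq_iff[OF equiv_connected_rel, of a b n G]
  by (simp add: tree_of_def Image_singleton_iff)

lemma isolated_rtrancl:
  assumes "G \<subseteq> A \<times> A" "v \<notin> A"
  shows "(v, y) \<in> (G \<union> G\<inverse>)\<^sup>* \<longleftrightarrow> y = v" "(y, v) \<in> (G \<union> G\<inverse>)\<^sup>* \<longleftrightarrow> y = v"
proof -
  have iso: "(v, z) \<notin> G \<union> G\<inverse>" "(z, v) \<notin> G \<union> G\<inverse>" for z
    using assms by auto
  have "y = v" if "(v, y) \<in> (G \<union> G\<inverse>)\<^sup>*"
    using that by (rule rtrancl_induct) (use iso(1) in metis)+
  then show "(v, y) \<in> (G \<union> G\<inverse>)\<^sup>* \<longleftrightarrow> y = v" by (metis rtrancl.rtrancl_refl)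
  have "y = v" if "(y, v) \<in> (G \<union> G\<inverse>)\<^sup>*"
    using that by (rule converse_rtrancl_induct) (use iso(2) in metis)+
  then show "(y, v) \<in> (G \<union> G\<inverse>)\<^sup>* \<longleftrightarrow> y = v" by (metis rtrancl.rtrancl_refl)
qed

lemma tree_of_subset:
  assumes "G \<subseteq> A \<times> A" "a \<in> A"
  shows "tree_of n G a \<subseteq> A"
proof
  fix b assume "b \<in> tree_of n G a"
  then have "(a, b) \<in> (G \<union> G\<inverse>)\<^sup>*" by (simp add: mem_tree_of)
  then show "b \<in> A" using isolated_rtrancl(2)[OF assms(1), of b a] assms(2) by metis
qed

lemma tree_of_isolated:
  assumes "G \<subseteq> A \<times> A" "v \<notin> A" "v \<in> {1..n}"
  shows "tree_of n G v = {v}"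
proof (rule set_eqI)
  fix y
  show "y \<in> tree_of n G v \<longleftrightarrow> y \<in> {v}"
    unfolding mem_tree_of isolated_rtrancl(1)[OF assms(1,2)] using assms(3) by auto
qed

text \<open>The only tree that changes is that of \<open>u\<close>, which absorbs the isolated vertex \<open>v\<close>.\<close>

lemma tree_of_insert_leaf:
  assumes G: "G \<subseteq> A \<times> A" and v: "v \<notin> A" "v \<in> {1..n}" and u: "u \<in> A" "u \<in> {1..n}"
  shows "tree_of n (insert (u, v) G) w =
    (if w \<in> insert v (tree_of n G u) then insert v (tree_of n G u) else tree_of n G w)"
proof -
  let ?R = "G \<union> G\<inverse>"
  have sym: "(x, y) \<in> ?R\<^sup>* \<longleftrightarrow> (y, x) \<in> ?R\<^sup>*" for x y
    by (meson symD sym_Un_converse sym_rtrancl)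
  have tr: "(x, y) \<in> ?R\<^sup>* \<Longrightarrow> (y, z) \<in> ?R\<^sup>* \<Longrightarrow> (x, z) \<in> ?R\<^sup>*" for x y z
    by (rule rtrancl_trans)
  have E: "insert (u, v) G \<union> (insert (u, v) G)\<inverse> = insert (u, v) (insert (v, u) ?R)" by auto
  have iso: "(v, y) \<in> ?R\<^sup>* \<longleftrightarrow> y = v" "(y, v) \<in> ?R\<^sup>* \<longleftrightarrow> y = v" for y
    using isolated_rtrancl[OF G v(1)] by auto
  have one: "(x, y) \<in> (insert (v, u) ?R)\<^sup>* \<longleftrightarrow> (x, y) \<in> ?R\<^sup>* \<or> x = v \<and> (u, y) \<in> ?R\<^sup>*" for x y
    by (simp add: rtrancl_insert iso)
  have two: "(x, y) \<in> (insert (u, v) (insert (v, u) ?R))\<^sup>* \<longleftrightarrow>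
      (x, y) \<in> ?R\<^sup>* \<or> (x = v \<or> (u, x) \<in> ?R\<^sup>*) \<and> (y = v \<or> (u, y) \<in> ?R\<^sup>*)" for x y
    unfolding rtrancl_insert[of u v] Un_iff mem_Collect_eq prod.case one iso using sym[of x u] tr[of x u y]
    by blast
  have *: "(x, y) \<in> (insert (u, v) (insert (v, u) ?R))\<^sup>* \<longleftrightarrow>
      (if x = v \<or> (u, x) \<in> ?R\<^sup>* then y = v \<or> (u, y) \<in> ?R\<^sup>* else (x, y) \<in> ?R\<^sup>*)" for x y
    unfolding two using iso(1)[of y] tr[of u x y]
    by (cases "x = v \<or> (u, x) \<in> ?R\<^sup>*") auto
  show ?thesis
  proof (cases "w \<in> {1..n}")
    case True
    have T: "x \<in> insert v (tree_of n G u) \<longleftrightarrow> x \<in> {1..n} \<and> (x = v \<or> (u, x) \<in> ?R\<^sup>*)" for x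
      using u v unfolding insert_iff mem_tree_of by blast
    have "x \<in> tree_of n (insert (u, v) G) w \<longleftrightarrow>
        x \<in> (if w \<in> insert v (tree_of n G u) then insert v (tree_of n G u) else tree_of n G w)" for x
      unfolding if_split_mem2 T mem_tree_of E * using True
      by (cases "w = v \<or> (u, w) \<in> ?R\<^sup>*") simp_all
    then show ?thesis by (rule set_eqI)
  next
    case False
    then have "w \<notin> insert v (tree_of n G u)" using v by (auto simp: mem_tree_of)
    moreover have "tree_of n H w = {}" for H using False by (auto simp: mem_tree_of)
    ultimately show ?thesis by simp
  qed
qed

text \<open>Sums over vertices of a function of the size of their tree are easier to update than the set of
trees. Counting each vertex with weight \<open>1 / s\<close> recovers sums over trees, see \<open>sum_trees\<close>.\<close>

definition size_sum :: "(nat \<Rightarrow> real) \<Rightarrow> nat \<Rightarrow> nat set \<Rightarrow> (nat \<times> nat) set \<Rightarrow> real" where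
  "size_sum f n A G = (\<Sum>w\<in>A. f (card (tree_of n G w)))"

lemma size_sum_isolated:
  assumes "G \<subseteq> A \<times> A" "v \<notin> A" "v \<in> {1..n}" "finite A"
  shows "size_sum f n (insert v A) G = size_sum f n A G + f 1"
  using assms tree_of_isolated[OF assms(1-3)] by (simp add: size_sum_def)

text \<open>The \<open>s\<close> vertices of the tree of \<open>u\<close> contributed \<open>f s\<close> each; now \<open>Suc s\<close> vertices contribute
\<open>f (Suc s)\<close> each.\<close>

lemma size_sum_insert_leaf:
  assumes G: "G \<subseteq> A \<times> A" and v: "v \<notin> A" "v \<in> {1..n}" and u: "u \<in> A" and A: "A \<subseteq> {1..n}"
  defines "s \<equiv> card (tree_of n G u)"
  shows "size_sum f n (insert v A) (insert (u, v) G) =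
    size_sum f n A G + (real (Suc s) * f (Suc s) - real s * f s)"
proof -
  let ?T = "tree_of n G u"
  have finA: "finite A" using A finite_subset by blast
  have T: "?T \<subseteq> A" by (rule tree_of_subset[OF G u])
  have u': "u \<in> {1..n}" using u A by auto
  have cT: "card (insert v ?T) = Suc s" using T v(1) by (auto simp: s_def card_insert_if)
  have new: "card (tree_of n (insert (u, v) G) w) = (if w \<in> insert v ?T then Suc s else card (tree_of n G w))"
    for w
    unfolding tree_of_insert_leaf[OF G v u u'] using cT by simp
  have "size_sum f n (insert v A) (insert (u, v) G) =
      (\<Sum>w\<in>insert v A. if w \<in> insert v ?T then f (Suc s) else f (card (tree_of n G w)))"
    unfolding size_sum_def by (intro sum.cong refl) (simp add: new del: insert_iff)
  also have "\<dots> = (\<Sum>w\<in>(A - ?T) \<union> insert v ?T.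
      if w \<in> insert v ?T then f (Suc s) else f (card (tree_of n G w)))"
    using T by (intro sum.cong) auto
  also have "\<dots> =
      (\<Sum>w\<in>A - ?T. f (card (tree_of n G w))) + real (Suc s) * f (Suc s)"
    using finA v(1) cT by (subst sum.union_disjoint) (auto intro!: sum.cong simp del: of_nat_Suc)
  also have "(\<Sum>w\<in>A - ?T. f (card (tree_of n G w))) =
      size_sum f n A G - (\<Sum>w\<in>?T. f (card (tree_of n G w)))"
    unfolding size_sum_def by (rule sum_diff[OF finA T])
  also have "(\<Sum>w\<in>?T. f (card (tree_of n G w))) = (\<Sum>w\<in>?T. f s)"
    by (intro sum.cong refl) (simp add: tree_of_eq s_def)
  finally show ?thesis by (simp add: s_def)
qed

text \<open>Each tree \<open>T\<close> is counted once for each of its \<open>card T\<close> vertices.\<close>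

lemma sum_trees:
  "(\<Sum>T\<in>trees n G. f (card T)) = size_sum (\<lambda>s. f s / real s) n {1..n} G"
proof -
  let ?q = "tree_of n G"
  have tr: "trees n G = ?q ` {1..n}" by (auto simp: trees_def tree_of_def quotient_def)
  have "size_sum (\<lambda>s. f s / real s) n {1..n} G =
      (\<Sum>T\<in>trees n G. \<Sum>w | w \<in> {1..n} \<and> ?q w = T. f (card (?q w)) / real (card (?q w)))"
    unfolding size_sum_def tr by (rule sum.image_gen) simp
  also have "\<dots> = (\<Sum>T\<in>trees n G. f (card T))"
  proof (rule sum.cong[OF refl])
    fix T assume "T \<in> trees n G"
    then obtain a where a: "a \<in> {1..n}" "T = ?q a" by (auto simp: tr)
    have "w \<in> {1..n} \<and> ?q w = T \<longleftrightarrow> w \<in> T" for w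
      using a self_in_tree_of[of w n G] tree_of_eq[of w n G a] mem_tree_of[of w n G a] by blast
    then have "{w. w \<in> {1..n} \<and> ?q w = T} = T" by simp
    then have "(\<Sum>w | w \<in> {1..n} \<and> ?q w = T. f (card (?q w)) / real (card (?q w))) =
        (\<Sum>w\<in>T. f (card T) / real (card T))"
      by (intro sum.cong) auto
    also have "card T > 0" using a card_tree_of_pos by blast
    then have "(\<Sum>w\<in>T. f (card T) / real (card T)) = f (card T)" by (auto simp: card_gt_0_iff)
    finally show "(\<Sum>w | w \<in> {1..n} \<and> ?q w = T. f (card (?q w)) / real (card (?q w))) = f (card T)" .
  qed
  finally show ?thesis ..
qed

section \<open>Mean number of vertices in trees of a given size\<close>

lemma expectation_bind_pmf_finite:
  fixes h :: "'b \<Rightarrow> real"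
  assumes "finite (set_pmf p)" "\<And>x. x \<in> set_pmf p \<Longrightarrow> finite (set_pmf (f x))"
  shows "measure_pmf.expectation (bind_pmf p f) h =
    measure_pmf.expectation p (\<lambda>x. measure_pmf.expectation (f x) h)"
  using assms by (subst pmf_expectation_bind[of "set_pmf p"])
    (auto simp: integral_measure_pmf_real[of "set_pmf p"] mult.commute)

lemma expectation_cong_pmf:
  assumes "\<And>x. x \<in> set_pmf p \<Longrightarrow> f x = g x"
  shows "measure_pmf.expectation p f = measure_pmf.expectation p g"
  using assms by (intro integral_cong_AE) (auto simp: AE_measure_pmf_iff)

lemma expectation_mono_pmf:
  fixes f g :: "'a \<Rightarrow> real"
  assumes "finite (set_pmf p)" "\<And>x. x \<in> set_pmf p \<Longrightarrow> f x \<le> g x"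
  shows "measure_pmf.expectation p f \<le> measure_pmf.expectation p g"
  using assms by (intro integral_mono_AE integrable_measure_pmf_finite) (auto simp: AE_measure_pmf_iff)

text \<open>Of the \<open>n - 1\<close> possible partners of \<open>v\<close>, those in \<open>xs\<close> create an edge and the others leave the forest
as it is.\<close>

lemma expectation_grow_Cons:
  fixes h :: "(nat \<times> nat) set \<Rightarrow> real"
  assumes n: "n \<ge> 2" and d: "distinct (v # xs)" and s: "set (v # xs) \<subseteq> {1..n}"
  shows "measure_pmf.expectation (grow n (v # xs)) h =
    measure_pmf.expectation (grow n xs) (\<lambda>G.
      ((\<Sum>u\<in>set xs. h (insert (u, v) G)) + (real (n - 1) - real (length xs)) * h G) / real (n - 1))"
proof -
  let ?V = "{1..n} - {v}"
  have cV: "card ?V = n - 1" using s by (subst card_Diff_singleton) auto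
  have "card ?V > 0" using cV n by linarith
  then have V: "finite ?V" "?V \<noteq> {}" unfolding card_gt_0_iff by auto
  have sub: "set xs \<subseteq> ?V" using d s by auto
  have cD: "card (?V - set xs) = n - 1 - length xs"
    using d cV card_Diff_subset[OF _ sub] by (simp add: distinct_card)
  have le: "length xs \<le> n - 1"
    using card_mono[OF V(1) sub] d cV by (simp add: distinct_card)
  have "measure_pmf.expectation (map_pmf (\<lambda>u. if u \<in> set xs then insert (u, v) G else G) (pmf_of_set ?V)) h =
      ((\<Sum>u\<in>set xs. h (insert (u, v) G)) + (real (n - 1) - real (length xs)) * h G) / real (n - 1)" for G
  proof -
    have "(\<Sum>u\<in>?V. h (if u \<in> set xs then insert (u, v) G else G)) =
        (\<Sum>u\<in>?V - set xs. h G) + (\<Sum>u\<in>set xs. h (insert (u, v) G))"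
      by (subst sum.subset_diff[OF sub V(1)]) (intro arg_cong2[of _ _ _ _ "(+)"] sum.cong; simp)
    also have "(\<Sum>u\<in>?V - set xs. h G) = (real (n - 1) - real (length xs)) * h G"
      by (simp only: sum_constant cD of_nat_diff[OF le])
    finally show ?thesis
      using V by (simp add: integral_pmf_of_set cV add.commute del: One_nat_def)
  qed
  moreover have "finite (set_pmf (grow n xs))" using finite_set_grow d by simp
  moreover have "finite (set_pmf (map_pmf (\<lambda>u. if u \<in> set xs then insert (u, v) G else G) (pmf_of_set ?V)))" for G
    using V by (simp add: set_pmf_of_set del: One_nat_def)
  ultimately show ?thesis
    by (simp add: expectation_bind_pmf_finite del: One_nat_def)
qed

text \<open>The probability that a Markov chain on the positive integers that starts at 1 and jumps from \<open>s\<close> to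
\<open>s + 1\<close> with probability \<open>s / N\<close>, and otherwise stays, is at \<open>k\<close> after \<open>m\<close> steps. The formula is the
discrete analogue of the binomial expansion of \<open>exp (- x) * (1 - exp (- x)) ^ (k - 1)\<close>; that it is
this probability is the content of \<open>yule_0\<close> and \<open>yule_Suc\<close>.\<close>

definition yule :: "nat \<Rightarrow> nat \<Rightarrow> nat \<Rightarrow> real" where
  "yule N m k = (\<Sum>i<k. (-1) ^ i * real ((k - 1) choose i) * (1 - (real i + 1) / real N) ^ m)"

lemma yule_0: "k \<ge> 1 \<Longrightarrow> yule N 0 k = of_bool (k = 1)"
proof -
  assume "k \<ge> 1"
  then obtain r where r: "k = Suc r" by (cases k) auto
  show ?thesis
    using choose_alternating_sum[of r, where ?'a = real]
    by (cases "r = 0") (auto simp: yule_def r lessThan_Suc_atMost)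
qed

lemma yule_Suc:
  assumes "N > 0" "k \<ge> 1"
  shows "yule N (Suc m) k =
    (1 - real k / real N) * yule N m k + (real k - 1) / real N * yule N m (k - 1)"
proof -
  obtain r where r: "k = Suc r" using assms(2) by (cases k) auto
  define c where "c i = (-1) ^ i * (1 - (real i + 1) / real N) ^ m" for i
  have absorb: "(real r - real i) * real (r choose i) = real r * real ((r - 1) choose i)" if "i \<le> r" for i
    using binomial_absorb_comp[of r i] that
    by (metis of_nat_diff of_nat_mult)
  have "yule N (Suc m) k - (1 - real k / real N) * yule N m k =
      (\<Sum>i<Suc r. c i * (((real r - real i) * real (r choose i)) / real N))"
    unfolding yule_def r c_def sum_distrib_left sum_subtractf[symmetric]
    using assms(1) by (intro sum.cong) (auto simp: field_simps)
  also have "\<dots> = (\<Sum>i<r. c i * (((real r - real i) * real (r choose i)) / real N))" by simp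
  also have "\<dots> = (\<Sum>i<r. c i * (real r * real ((r - 1) choose i) / real N))"
    by (intro sum.cong refl) (simp add: absorb)
  also have "\<dots> = (real k - 1) / real N * yule N m (k - 1)"
    unfolding yule_def r c_def sum_distrib_left by (intro sum.cong) (auto simp: field_simps)
  finally show ?thesis by simp
qed

definition count_in_size :: "nat \<Rightarrow> nat \<Rightarrow> nat list \<Rightarrow> (nat \<times> nat) set \<Rightarrow> real" where
  "count_in_size k n xs = size_sum (\<lambda>s. of_bool (s = k)) n (set xs)"

text \<open>If the new vertex joins a tree of size \<open>k\<close>, then \<open>k\<close> vertices leave the count; if it joins a tree of
size \<open>k - 1\<close>, then \<open>k\<close> vertices enter it. The probability of joining some tree of a given size is
proportional to the number of vertices in such trees, so the expectations satisfy a closed linear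
recursion.\<close>

lemma expectation_in_size_Cons:
  assumes n: "n \<ge> 2" and d: "distinct (v # xs)" and s: "set (v # xs) \<subseteq> {1..n}" and k: "k \<ge> 1"
  defines "N \<equiv> real (n - 1)"
  shows "measure_pmf.expectation (grow n (v # xs)) (count_in_size k n (v # xs)) =
    (1 - real k / N) * measure_pmf.expectation (grow n xs) (count_in_size k n xs)
    + real k / N * measure_pmf.expectation (grow n xs) (count_in_size (k - 1) n xs)
    + of_bool (k = 1) * (1 - real (length xs) / N)"
proof -
  have N: "N > 0" using n by (simp add: N_def)
  have fin: "finite (set_pmf (grow n xs))" using finite_set_grow d by simp
  have "((\<Sum>u\<in>set xs. count_in_size k n (v # xs) (insert (u, v) G)) + (N - real (length xs)) * count_in_size k n (v # xs) G) / N
      = (1 - real k / N) * count_in_size k n xs G + real k / N * count_in_size (k - 1) n xs G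
        + of_bool (k = 1) * (1 - real (length xs) / N)"
    if "G \<in> set_pmf (grow n xs)" for G
  proof -
    let ?s = "\<lambda>u. card (tree_of n G u)"
    have G: "G \<subseteq> set xs \<times> set xs" using set_grow[OF that] d by simp
    have v: "v \<notin> set xs" "v \<in> {1..n}" using d s by auto
    have sx: "set xs \<subseteq> {1..n}" using s by auto
    have "count_in_size k n (v # xs) (insert (u, v) G) =
        count_in_size k n xs G + (real k * of_bool (?s u = k - 1) - real k * of_bool (?s u = k))"
      if "u \<in> set xs" for u
      unfolding count_in_size_def using size_sum_insert_leaf[OF G v that sx] k by (auto simp: of_bool_def)
    then have S: "(\<Sum>u\<in>set xs. count_in_size k n (v # xs) (insert (u, v) G)) =
        real (length xs) * count_in_size k n xs G + real k * count_in_size (k - 1) n xs G - real k * count_in_size k n xs G"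
      using d by (simp add: sum.distrib sum_subtractf distinct_card count_in_size_def size_sum_def
        flip: sum_distrib_left)
    have I: "count_in_size k n (v # xs) G = count_in_size k n xs G + of_bool (k = 1)"
      unfolding count_in_size_def using size_sum_isolated[OF G v] by (simp add: of_bool_def)
    show ?thesis unfolding S I using N by (simp add: field_simps)
  qed
  then have "measure_pmf.expectation (grow n (v # xs)) (count_in_size k n (v # xs)) =
      measure_pmf.expectation (grow n xs) (\<lambda>G. (1 - real k / N) * count_in_size k n xs G
        + real k / N * count_in_size (k - 1) n xs G + of_bool (k = 1) * (1 - real (length xs) / N))"
    unfolding expectation_grow_Cons[OF n d s] N_def by (intro expectation_cong_pmf)
  also have "\<dots> = (1 - real k / N) * measure_pmf.expectation (grow n xs) (count_in_size k n xs)
    + real k / N * measure_pmf.expectation (grow n xs) (count_in_size (k - 1) n xs)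
    + of_bool (k = 1) * (1 - real (length xs) / N)"
    by (simp add: integrable_measure_pmf_finite fin)
  finally show ?thesis .
qed

lemma count_in_size_0:
  assumes "set xs \<subseteq> {1..n}"
  shows "count_in_size 0 n xs G = 0"
  using assms card_tree_of_pos[of _ n G] by (force simp: count_in_size_def size_sum_def intro!: sum.neutral)

text \<open>The \<open>i\<close>-th summand accounts for a tree started by the vertex that found \<open>i\<close> vertices present, which
has then grown during \<open>length xs - Suc i\<close> steps.\<close>

lemma expectation_in_size_grow:
  assumes n: "n \<ge> 2" and "distinct xs" "set xs \<subseteq> {1..n}"
  shows "measure_pmf.expectation (grow n xs) (count_in_size k n xs) =
    real k * (\<Sum>i<length xs. (1 - real i / real (n - 1)) * yule (n - 1) (length xs - Suc i) k)"
  using assms(2,3)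
proof (induction xs arbitrary: k)
  case Nil
  show ?case by (simp add: count_in_size_def size_sum_def)
next
  case (Cons v xs)
  let ?N = "n - 1" and ?j = "length xs"
  let ?b = "\<lambda>i. 1 - real i / real ?N"
  have N: "?N > 0" using n by simp
  show ?case
  proof (cases "k = 0")
    case True
    then show ?thesis using Cons.prems(2) by (simp only: count_in_size_0) simp
  next
    case False
    then have k: "k \<ge> 1" by simp
    have IH: "measure_pmf.expectation (grow n xs) (count_in_size l n xs) =
      real l * (\<Sum>i<?j. ?b i * yule ?N (?j - Suc i) l)" for l
      using Cons by simp
    have "(\<Sum>i<length (v # xs). ?b i * yule ?N (length (v # xs) - Suc i) k) =
        (\<Sum>i<?j. ?b i * yule ?N (Suc (?j - Suc i)) k) + ?b ?j * of_bool (k = 1)"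
      by (simp add: yule_0[OF k] Suc_diff_Suc del: One_nat_def)
    also have "(\<Sum>i<?j. ?b i * yule ?N (Suc (?j - Suc i)) k) =
        (1 - real k / real ?N) * (\<Sum>i<?j. ?b i * yule ?N (?j - Suc i) k)
        + (real k - 1) / real ?N * (\<Sum>i<?j. ?b i * yule ?N (?j - Suc i) (k - 1))"
      unfolding yule_Suc[OF N k] sum_distrib_left sum.distrib[symmetric]
      by (intro sum.cong refl) (simp only: distrib_left mult.left_commute)
    finally have R: "(\<Sum>i<length (v # xs). ?b i * yule ?N (length (v # xs) - Suc i) k) = \<dots> + ?b ?j * of_bool (k = 1)" .
    have "(1 - real k / N) * (real k * S) + real k / N * (real (k - 1) * S') + of_bool (k = 1) * c =
        real k * ((1 - real k / N) * S + (real k - 1) / N * S' + c * of_bool (k = 1))" for S S' c N :: real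
      using k by (simp add: of_nat_diff algebra_simps diff_divide_distrib)
    then show ?thesis
      unfolding expectation_in_size_Cons[OF n Cons.prems k] IH R .
  qed
qed

lemma permutation_of_vertices:
  assumes "xs \<in> set_pmf (pmf_of_set (permutations_of_set {1..n}))"
  shows "set xs = {1..n}" "distinct xs" "length xs = n"
proof -
  have "xs \<in> permutations_of_set {1..n}"
    using assms by (subst (asm) set_pmf_of_set) simp_all
  then show xs: "set xs = {1..n}" "distinct xs" by (rule permutations_of_setD)+
  then show "length xs = n" using distinct_card[of xs] by simp
qed

lemma expectation_moran_forest:
  fixes h :: "(nat \<times> nat) set \<Rightarrow> real"
  assumes n: "n \<ge> 2"
  shows "measure_pmf.expectation (moran_forest n) h =
    measure_pmf.expectation (pmf_of_set (permutations_of_set {1..n}))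
      (\<lambda>xs. measure_pmf.expectation (grow n xs) h)"
  unfolding moran_forest_eq_grown_forest[OF n] grown_forest_def
proof (rule expectation_bind_pmf_finite)
  show "finite (set_pmf (pmf_of_set (permutations_of_set {1..n})))"
    by (subst set_pmf_of_set) simp_all
qed (rule finite_set_grow[OF permutation_of_vertices(2)])

lemma expectation_size_moran_forest:
  assumes n: "n \<ge> 2"
  shows "measure_pmf.expectation (moran_forest n) (size_sum (\<lambda>s. of_bool (s = k)) n {1..n}) =
    real k * (\<Sum>m<n. real m / real (n - 1) * yule (n - 1) m k)"
proof -
  have "measure_pmf.expectation (grow n xs) (size_sum (\<lambda>s. of_bool (s = k)) n {1..n}) =
      real k * (\<Sum>m<n. real m / real (n - 1) * yule (n - 1) m k)"
    if "xs \<in> set_pmf (pmf_of_set (permutations_of_set {1..n}))" for xs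
  proof -
    note xs = permutation_of_vertices[OF that]
    have "(\<Sum>m<n. real m / real (n - 1) * yule (n - 1) m k) =
        (\<Sum>i<n. real (n - Suc i) / real (n - 1) * yule (n - 1) (n - Suc i) k)"
      by (rule sum.nat_diff_reindex[symmetric])
    also have "\<dots> = (\<Sum>i<n. (1 - real i / real (n - 1)) * yule (n - 1) (n - Suc i) k)"
      using n by (intro sum.cong refl) (auto simp: field_simps of_nat_diff)
    finally show ?thesis
      using expectation_in_size_grow[OF n, of xs k] xs by (simp add: count_in_size_def)
  qed
  then have "measure_pmf.expectation (pmf_of_set (permutations_of_set {1..n})) (\<lambda>xs.
        measure_pmf.expectation (grow n xs) (size_sum (\<lambda>s. of_bool (s = k)) n {1..n})) =
      measure_pmf.expectation (pmf_of_set (permutations_of_set {1..n}))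
        (\<lambda>_. real k * (\<Sum>m<n. real m / real (n - 1) * yule (n - 1) m k))"
    by (rule expectation_cong_pmf)
  then show ?thesis unfolding expectation_moran_forest[OF n] by simp
qed

section \<open>Concentration of the number of trees\<close>

text \<open>Each vertex starts a new tree with a probability that does not depend on the forest present, so the
number of trees is a sum of independent indicators. The sum that is subtracted is its mean, and each
indicator has variance at most \<open>1/4\<close>. Weighting each vertex with the inverse of its tree size counts
the trees, and attaching a leaf leaves this count unchanged.\<close>

lemma expectation_tree_count_grow:
  assumes n: "n \<ge> 2" and "distinct xs" "set xs \<subseteq> {1..n}"
  shows "measure_pmf.expectation (grow n xs)
      (\<lambda>G. (size_sum (\<lambda>s. 1 / real s) n (set xs) G - (\<Sum>i<length xs. 1 - real i / real (n - 1)))\<^sup>2)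
    \<le> real (length xs) / 4"
  using assms(2,3)
proof (induction xs)
  case Nil
  show ?case by (simp add: size_sum_def)
next
  case (Cons v xs)
  let ?C = "\<lambda>xs. size_sum (\<lambda>s. 1 / real s) n (set xs)"
  let ?c = "\<lambda>j. \<Sum>i<j. 1 - real i / real (n - 1)"
  let ?j = "length xs"
  define b where "b = 1 - real ?j / real (n - 1)"
  have N: "real (n - 1) > 0" using n by simp
  have fin: "finite (set_pmf (grow n xs))" using finite_set_grow Cons.prems by simp
  have "((\<Sum>u\<in>set xs. (?C (v # xs) (insert (u, v) G) - ?c (Suc ?j))\<^sup>2)
      + (real (n - 1) - real ?j) * (?C (v # xs) G - ?c (Suc ?j))\<^sup>2) / real (n - 1)
    \<le> (?C xs G - ?c ?j)\<^sup>2 + 1 / 4" if "G \<in> set_pmf (grow n xs)" for G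
  proof -
    let ?x = "?C xs G - ?c ?j"
    have G: "G \<subseteq> set xs \<times> set xs" using set_grow[OF that] Cons.prems by simp
    have v: "v \<notin> set xs" "v \<in> {1..n}" using Cons.prems by auto
    have sx: "set xs \<subseteq> {1..n}" using Cons.prems by auto
    have "?C (v # xs) (insert (u, v) G) = ?C xs G" if "u \<in> set xs" for u
    proof -
      have "tree_of n G u \<noteq> {}" using self_in_tree_of[of u n G] that sx by auto
      then show ?thesis using size_sum_insert_leaf[OF G v that sx, of "\<lambda>s. 1 / real s"] by simp
    qed
    then have S: "(\<Sum>u\<in>set xs. (?C (v # xs) (insert (u, v) G) - ?c (Suc ?j))\<^sup>2) = real ?j * (?x - b)\<^sup>2"
      using Cons.prems by (simp add: distinct_card b_def algebra_simps)
    have I: "?C (v # xs) G - ?c (Suc ?j) = ?x + 1 - b"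
      using size_sum_isolated[OF G v, of "\<lambda>s. 1 / real s"] by (simp add: b_def)
    have "(p * X + (M - p) * Y) / M = p / M * X + (1 - p / M) * Y" if "M > 0" for p X Y M :: real
      using that by (simp add: field_simps)
    then have "((\<Sum>u\<in>set xs. (?C (v # xs) (insert (u, v) G) - ?c (Suc ?j))\<^sup>2)
      + (real (n - 1) - real ?j) * (?C (v # xs) G - ?c (Suc ?j))\<^sup>2) / real (n - 1) =
      (real ?j / real (n - 1)) * (?x - b)\<^sup>2 + (1 - real ?j / real (n - 1)) * (?x + 1 - b)\<^sup>2"
      unfolding S I using N by blast
    also have "\<dots> = (1 - b) * (?x - b)\<^sup>2 + b * (?x + 1 - b)\<^sup>2" by (simp add: b_def)
    also have "\<dots> = ?x\<^sup>2 + b * (1 - b)" by (simp add: power2_eq_square algebra_simps)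
    \<comment> \<open>The mixed term has vanished since \<open>b\<close> is the probability of a new tree; what is left is the
      variance of an indicator.\<close>
    also have "b * (1 - b) \<le> 1 / 4"
      using zero_le_power2[of "b - 1 / 2"] by (simp add: power2_eq_square algebra_simps)
    finally show ?thesis by simp
  qed
  then have "measure_pmf.expectation (grow n (v # xs)) (\<lambda>G. (?C (v # xs) G - ?c (length (v # xs)))\<^sup>2)
      \<le> measure_pmf.expectation (grow n xs) (\<lambda>G. (?C xs G - ?c ?j)\<^sup>2 + 1 / 4)"
    unfolding expectation_grow_Cons[OF n Cons.prems] length_Cons
    by (intro expectation_mono_pmf[OF fin])
  also have "\<dots> = measure_pmf.expectation (grow n xs) (\<lambda>G. (?C xs G - ?c ?j)\<^sup>2) + 1 / 4"
    by (simp add: integrable_measure_pmf_finite fin)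
  also have "\<dots> \<le> real (length (v # xs)) / 4" using Cons by simp
  finally show ?case .
qed

lemma card_trees_eq: "real (card (trees n G)) = size_sum (\<lambda>s. 1 / real s) n {1..n} G"
  using sum_trees[of "\<lambda>_. 1" n G] by simp

lemma second_moment_card_trees:
  assumes n: "n \<ge> 2"
  shows "measure_pmf.expectation (moran_forest n) (\<lambda>G. (real (card (trees n G)) - real n / 2)\<^sup>2) \<le> real n / 4"
proof -
  have "(\<Sum>i<n. real i) = real n * (real n - 1) / 2"
    by (induction n) (auto simp: field_simps)
  then have "(\<Sum>i<n. real i) = real n * real (n - 1) / 2"
    using n by (simp add: of_nat_diff)
  moreover have "(\<Sum>i<n. 1 - real i / real (n - 1)) = real n - (\<Sum>i<n. real i) / real (n - 1)"
    by (simp add: sum_subtractf sum_divide_distrib)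
  ultimately have mean: "(\<Sum>i<n. 1 - real i / real (n - 1)) = real n / 2"
    using n by simp
  have "measure_pmf.expectation (grow n xs) (\<lambda>G. (real (card (trees n G)) - real n / 2)\<^sup>2) \<le> real n / 4"
    if "xs \<in> set_pmf (pmf_of_set (permutations_of_set {1..n}))" for xs
  proof -
    note xs = permutation_of_vertices[OF that]
    show ?thesis
      using expectation_tree_count_grow[OF n xs(2)] unfolding xs(1,3) mean card_trees_eq by blast
  qed
  then have "measure_pmf.expectation (moran_forest n) (\<lambda>G. (real (card (trees n G)) - real n / 2)\<^sup>2)
      \<le> measure_pmf.expectation (pmf_of_set (permutations_of_set {1..n})) (\<lambda>_. real n / 4)"
    unfolding expectation_moran_forest[OF n]
  proof (rule expectation_mono_pmf[rotated])
    show "finite (set_pmf (pmf_of_set (permutations_of_set {1..n})))"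
      by (subst set_pmf_of_set) simp_all
  qed  then show ?thesis by simp
qed

section \<open>The limiting integral\<close>

definition mixture :: "nat \<Rightarrow> real" where
  "mixture k = (LINT x:{0..1}|lborel. x * exp (- x) * (1 - exp (- x)) ^ (k - 1))"

text \<open>The integral of \<open>x * exp (- a * x)\<close> over the unit interval.\<close>

definition mixture_term :: "real \<Rightarrow> real" where
  "mixture_term a = (1 - (1 + a) * exp (- a)) / a\<^sup>2"

text \<open>Binomial expansion of the power of \<open>1 - exp (- x)\<close>, followed by termwise integration.\<close>

lemma mixture_eq_sum:
  assumes "k \<ge> 1"
  shows "mixture k = (\<Sum>i<k. (-1) ^ i * real ((k - 1) choose i) * mixture_term (real i + 1))"
proof -
  let ?c = "\<lambda>i. (-1) ^ i * real ((k - 1) choose i)"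
  define F where "F x = (\<Sum>i<k. ?c i * (- ((1 + (real i + 1) * x) * exp (- (real i + 1) * x) / (real i + 1)\<^sup>2)))" for x
  define f where "f x = x * exp (- x) * (1 - exp (- x)) ^ (k - 1)" for x :: real
  have F': "(F has_real_derivative f x) (at x)" for x
  proof -
    have d: "((\<lambda>x. - ((1 + a * x) * exp (- a * x) / a\<^sup>2)) has_real_derivative x * exp (- a * x)) (at x)"
      if "a > 0" for a
      using that by (auto intro!: derivative_eq_intros simp: field_simps power2_eq_square)
    have "(F has_real_derivative (\<Sum>i<k. ?c i * (x * exp (- (real i + 1) * x)))) (at x)"
      unfolding F_def by (intro DERIV_sum DERIV_cmult d) simp
    also have "(\<Sum>i<k. ?c i * (x * exp (- (real i + 1) * x))) =
        x * exp (- x) * (\<Sum>i\<le>k - 1. real ((k - 1) choose i) * (- exp (- x)) ^ i * 1 ^ (k - 1 - i))"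
    proof -
      have "exp (- (real i + 1) * x) = exp (- x) * exp (- x) ^ i" for i
        by (simp add: algebra_simps flip: exp_add exp_of_nat_mult)
      moreover have "(- exp (- x)) ^ i = (-1) ^ i * exp (- x) ^ i" for i
        by (rule power_minus)
      moreover have "{..<k} = {..k - 1}" using assms by auto
      ultimately show ?thesis
        unfolding sum_distrib_left by (intro sum.cong) (auto simp: mult_ac)
    qed
    also have "\<dots> = f x" unfolding f_def binomial_ring[symmetric] by simp
    finally show ?thesis .
  qed
  have "mixture k = (\<integral>x. f x * indicator {0..1} x \<partial>lborel)"
    by (simp add: mixture_def set_lebesgue_integral_def f_def mult.commute)
  also have "\<dots> = F 1 - F 0"
    by (rule integral_FTC_Icc_real) (auto simp: F', auto simp: f_def intro!: continuous_intros)
  also have "\<dots> = (\<Sum>i<k. ?c i * mixture_term (real i + 1))"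
    unfolding F_def mixture_term_def sum_subtractf[symmetric] right_diff_distrib[symmetric]
    by (intro sum.cong refl arg_cong[of _ _ "(*) _"]) (simp add: diff_divide_distrib)
  finally show ?thesis .
qed

lemma arith_geom_sum:
  fixes r :: real
  shows "(1 - r)\<^sup>2 * (\<Sum>m<Suc N. real m * r ^ m) = r * (1 - (real N + 1) * r ^ N + real N * r ^ Suc N)"
proof (induction N)
  case (Suc N)
  then show ?case
    by (subst sum.lessThan_Suc) (simp add: distrib_left power2_eq_square algebra_simps)
qed simp

text \<open>This is a Riemann sum for the integral of \<open>x * exp (- a * x)\<close>, but with powers of \<open>1 - a / N\<close> in place
of the exponential. Being an arithmetico-geometric sum, it has a closed form whose limit can be read
off.\<close>

lemma tendsto_arith_geom_sum:
  fixes a :: real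
  assumes a: "a > 0"
  shows "(\<lambda>N. (\<Sum>m<Suc N. real m / real N * (1 - a / real N) ^ m) / real N) \<longlonglongrightarrow> mixture_term a"
proof -
  have ev: "(\<Sum>m<Suc N. real m / real N * (1 - a / real N) ^ m) / real N =
      (1 - a / real N) * (1 - (1 + a) * (1 - a / real N) ^ N) / a\<^sup>2" if "N \<ge> 1" for N
  proof -
    let ?r = "1 - a / real N"
    have N: "real N > 0" using that by simp
    have "(a / real N)\<^sup>2 * (\<Sum>m<Suc N. real m * ?r ^ m) =
        ?r * (1 - (real N + 1) * ?r ^ N + real N * ?r ^ Suc N)"
      using arith_geom_sum[of ?r N] by simp
    also have "real N * ?r ^ Suc N = (real N - a) * ?r ^ N"
      using N by (simp add: field_simps)
    finally have "(a / real N)\<^sup>2 * (\<Sum>m<Suc N. real m * ?r ^ m) = ?r * (1 - (1 + a) * ?r ^ N)"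
      by (simp add: algebra_simps)
    moreover have "(\<Sum>m<Suc N. real m / real N * ?r ^ m) = (\<Sum>m<Suc N. real m * ?r ^ m) / real N"
      by (simp add: sum_divide_distrib del: sum.lessThan_Suc)
    then have "(\<Sum>m<Suc N. real m / real N * ?r ^ m) / real N =
        (a / real N)\<^sup>2 * (\<Sum>m<Suc N. real m * ?r ^ m) / a\<^sup>2"
      using a N by (simp add: power2_eq_square field_simps del: sum.lessThan_Suc)
    ultimately show ?thesis by simp
  qed
  have "(\<lambda>N. (1 + (- a) / real N) ^ N) \<longlonglongrightarrow> exp (- a)"
    by (rule tendsto_exp_limit_sequentially)
  moreover have "(\<lambda>N. a / real N) \<longlonglongrightarrow> 0" by (rule lim_const_over_n)
  ultimately have "(\<lambda>N. (1 - a / real N) * (1 - (1 + a) * (1 - a / real N) ^ N) / a\<^sup>2)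
      \<longlonglongrightarrow> (1 - 0) * (1 - (1 + a) * exp (- a)) / a\<^sup>2"
    using a by (intro tendsto_intros) auto
  then have "(\<lambda>N. (1 - a / real N) * (1 - (1 + a) * (1 - a / real N) ^ N) / a\<^sup>2) \<longlonglongrightarrow> mixture_term a"
    by (simp add: mixture_term_def)
  then show ?thesis
    by (rule Lim_transform_eventually[OF _ eventually_sequentiallyI[of 1]]) (rule ev[symmetric])
qed

lemma tendsto_yule_sum:
  assumes "k \<ge> 1"
  shows "(\<lambda>N. (\<Sum>m<Suc N. real m / real N * yule N m k) / real N) \<longlonglongrightarrow> mixture k"
proof -
  let ?c = "\<lambda>i. (-1) ^ i * real ((k - 1) choose i)"
  have "(\<Sum>m<Suc N. real m / real N * yule N m k) / real N =
      (\<Sum>i<k. ?c i * ((\<Sum>m<Suc N. real m / real N * (1 - (real i + 1) / real N) ^ m) / real N))" for N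
    unfolding yule_def sum_divide_distrib sum_distrib_left
    by (subst sum.swap) (intro sum.cong refl, simp)
  then show ?thesis
    unfolding mixture_eq_sum[OF assms]
    by (simp only:) (intro tendsto_sum tendsto_mult tendsto_const tendsto_arith_geom_sum; simp)
qed

lemma tendsto_mean_size:
  assumes "k \<ge> 1"
  shows "(\<lambda>n. measure_pmf.expectation (moran_forest n)
      (size_sum (\<lambda>s. of_bool (s = k)) n {1..n}) / real n) \<longlonglongrightarrow> real k * mixture k"
    (is "?E \<longlonglongrightarrow> _")
proof -
  have "(\<lambda>N. real N / real (Suc N)) \<longlonglongrightarrow> 1" by (rule LIMSEQ_n_over_Suc_n)
  then have "(\<lambda>N. real k * (real N / real (Suc N)) *
      ((\<Sum>m<Suc N. real m / real N * yule N m k) / real N)) \<longlonglongrightarrow> real k * 1 * mixture k"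
    using assms by (intro tendsto_intros tendsto_yule_sum)
  then have "(\<lambda>N. real k * (real N / real (Suc N)) *
      ((\<Sum>m<Suc N. real m / real N * yule N m k) / real N)) \<longlonglongrightarrow> real k * mixture k"
    by (simp only: mult_1_right)
  moreover have "real k * (real N / real (Suc N)) *
      ((\<Sum>m<Suc N. real m / real N * yule N m k) / real N) = ?E (Suc N)" if "N \<ge> 1" for N
  proof -
    have "real k * (real N / real (Suc N)) * (S / real N) = real k * S / real (Suc N)" for S
      using that by simp
    then show ?thesis using that expectation_size_moran_forest[of "Suc N" k] by (simp del: sum.lessThan_Suc)
  qed
  ultimately have "(\<lambda>N. ?E (Suc N)) \<longlonglongrightarrow> real k * mixture k"
    by (rule Lim_transform_eventually[OF _ eventually_sequentiallyI[of 1]])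
  then show ?thesis by (rule LIMSEQ_imp_Suc)
qed

section \<open>Convergence of the probabilities\<close>

lemma finite_set_moran_forest: "n \<ge> 2 \<Longrightarrow> finite (set_pmf (moran_forest n))"
  by (rule finite_subset[OF _ finite_digraphs[of n]])
     (use moran_stationary_grown_forest[of n] in \<open>simp add: moran_forest_eq_grown_forest moran_stationary_def\<close>)

lemma pmf_map_eq_expectation:
  "pmf (map_pmf g p) k = measure_pmf.expectation p (\<lambda>x. of_bool (g x = k))"
proof -
  have "pmf (map_pmf g p) k = measure_pmf.prob p (g -` {k})" by (rule pmf_map)
  also have "\<dots> = measure_pmf.expectation p (indicator (g -` {k}))" by simp
  also have "indicator (g -` {k}) = (\<lambda>x. of_bool (g x = k) :: real)"
    by (auto simp: indicator_def fun_eq_iff)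
  finally show ?thesis .
qed

text \<open>Relabelling maps paths to paths. For an involution, applying this twice gives equality.\<close>

lemma card_tree_of_relabel_le:
  assumes "bij_betw \<sigma> {1..n} {1..n}" "a \<in> {1..n}"
  shows "card (tree_of n G a) \<le> card (tree_of n (relabel \<sigma> G) (\<sigma> a))"
proof (rule card_inj_on_le)
  have \<sigma>: "\<sigma> x \<in> {1..n}" if "x \<in> {1..n}" for x
    using assms(1) that by (rule bij_betwE[rule_format])
  show "inj_on \<sigma> (tree_of n G a)"
    using assms(1) by (rule inj_on_subset[OF bij_betw_imp_inj_on]) (simp add: mem_tree_of subset_iff)
  show "\<sigma> ` tree_of n G a \<subseteq> tree_of n (relabel \<sigma> G) (\<sigma> a)"
  proof (rule image_subsetI)
    fix b assume b: "b \<in> tree_of n G a"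
    then have "(a, b) \<in> (G \<union> G\<inverse>)\<^sup>*" by (simp add: mem_tree_of)
    then have "(\<sigma> a, \<sigma> b) \<in> (relabel \<sigma> G \<union> (relabel \<sigma> G)\<inverse>)\<^sup>*"
    proof (rule rtrancl_induct)
      fix x y
      assume "(\<sigma> a, \<sigma> x) \<in> (relabel \<sigma> G \<union> (relabel \<sigma> G)\<inverse>)\<^sup>*" and "(x, y) \<in> G \<union> G\<inverse>"
      from this(2) have "(\<sigma> x, \<sigma> y) \<in> relabel \<sigma> G \<union> (relabel \<sigma> G)\<inverse>"
        using imageI[of "(x, y)" G "map_prod \<sigma> \<sigma>"] imageI[of "(y, x)" G "map_prod \<sigma> \<sigma>"]
        unfolding relabel_def by auto
      with \<open>(\<sigma> a, \<sigma> x) \<in> _\<close> show "(\<sigma> a, \<sigma> y) \<in> (relabel \<sigma> G \<union> (relabel \<sigma> G)\<inverse>)\<^sup>*"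
        by (rule rtrancl.rtrancl_into_rtrancl)
    qed simp
    moreover have "b \<in> {1..n}" using b by (simp add: mem_tree_of)
    ultimately show "\<sigma> b \<in> tree_of n (relabel \<sigma> G) (\<sigma> a)"
      unfolding mem_tree_of using \<sigma> assms(2) by (intro conjI)
  qed
qed simp

text \<open>The transposition of 1 and \<open>w\<close> preserves the law of the forest and exchanges the two trees.\<close>

lemma map_card_tree_of_moran_forest:
  assumes n: "n \<ge> 2" and w: "w \<in> {1..n}"
  shows "map_pmf (\<lambda>G. card (tree_of n G w)) (moran_forest n) = vertex1_tree_size n"
proof -
  define \<sigma> where "\<sigma> = Transposition.transpose 1 w"
  have "\<sigma> permutes {1..n}" unfolding \<sigma>_def using n w by (intro permutes_swap_id) auto
  then have \<sigma>: "bij_betw \<sigma> {1..n} {1..n}" "inj \<sigma>"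
    by (auto simp: permutes_imp_bij permutes_inj)
  have inv: "relabel \<sigma> (relabel \<sigma> G) = G" for G
    by (simp add: relabel_def image_image map_prod_def case_prod_beta \<sigma>_def)
  have \<sigma>1: "\<sigma> 1 = w" "\<sigma> w = 1" by (simp_all add: \<sigma>_def)
  have "card (tree_of n (relabel \<sigma> G) w) = card (tree_of n G 1)" for G
    using card_tree_of_relabel_le[OF \<sigma>(1), of 1 G] card_tree_of_relabel_le[OF \<sigma>(1) w, of "relabel \<sigma> G"] n
    unfolding \<sigma>1 inv by (intro antisym) auto
  then have "map_pmf (\<lambda>G. card (tree_of n G w)) (map_pmf (relabel \<sigma>) (moran_forest n)) = vertex1_tree_size n"
    by (simp add: pmf.map_comp o_def vertex1_tree_size_def)
  then show ?thesis by (simp add: map_relabel_moran_forest[OF n \<sigma>])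
qed

lemma pmf_vertex1_tree_size:
  assumes n: "n \<ge> 2"
  shows "pmf (vertex1_tree_size n) k =
    measure_pmf.expectation (moran_forest n) (size_sum (\<lambda>s. of_bool (s = k)) n {1..n}) / real n"
proof -
  have "measure_pmf.expectation (moran_forest n) (size_sum (\<lambda>s. of_bool (s = k)) n {1..n}) =
      (\<Sum>w\<in>{1..n}. measure_pmf.expectation (moran_forest n) (\<lambda>G. of_bool (card (tree_of n G w) = k)))"
    unfolding size_sum_def
    by (rule Bochner_Integration.integral_sum) (simp add: integrable_measure_pmf_finite finite_set_moran_forest[OF n])
  also have "\<dots> = (\<Sum>w\<in>{1..n}. pmf (vertex1_tree_size n) k)"
    by (intro sum.cong refl)
       (simp add: map_card_tree_of_moran_forest[OF n, symmetric] pmf_map_eq_expectation)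
  finally show ?thesis using n by simp
qed

lemma tendsto_vertex1_tree_size:
  assumes "k \<ge> 1"
  shows "(\<lambda>n. pmf (vertex1_tree_size n) k) \<longlonglongrightarrow> real k * mixture k"
  using tendsto_mean_size[OF assms]
  by (rule Lim_transform_eventually[OF _ eventually_sequentiallyI[of 2]])
     (simp add: pmf_vertex1_tree_size)

lemma finite_trees [simp]: "finite (trees n G)"
  by (simp add: trees_def quotient_def)

lemma trees_nonempty: "n \<ge> 1 \<Longrightarrow> trees n G \<noteq> {}"
  by (auto simp: trees_def quotient_def)

lemma pmf_uniform_tree_size:
  assumes n: "n \<ge> 2"
  shows "pmf (uniform_tree_size n) k =
    measure_pmf.expectation (moran_forest n)
      (\<lambda>G. size_sum (\<lambda>s. of_bool (s = k) / real s) n {1..n} G / real (card (trees n G)))"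
proof -
  have "pmf (map_pmf card (pmf_of_set (trees n G))) k =
      size_sum (\<lambda>s. of_bool (s = k) / real s) n {1..n} G / real (card (trees n G))" for G
    unfolding pmf_map_eq_expectation sum_trees[symmetric]
    using trees_nonempty[of n G] n by (subst integral_pmf_of_set) auto
  then show ?thesis by (simp add: uniform_tree_size_def pmf_bind)
qed

text \<open>With \<open>D\<close> the number of trees of size \<open>k\<close> and \<open>C\<close> the number of all trees, \<open>D / C \<le> 1\<close> gives
\<open>\<bar>D / C - 2 * D / n\<bar> \<le> \<bar>1 - 2 * C / n\<bar>\<close>, and the right hand side has second moment at most \<open>1 / n\<close>.\<close>

lemma uniform_tree_size_approx:
  assumes n: "n \<ge> 2" and k: "k \<ge> 1"
  shows "\<bar>pmf (uniform_tree_size n) k - 2 / real k *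
    (measure_pmf.expectation (moran_forest n) (size_sum (\<lambda>s. of_bool (s = k)) n {1..n}) / real n)\<bar>
    \<le> 1 / sqrt (real n)"
proof -
  let ?E = "measure_pmf.expectation (moran_forest n)"
  let ?D = "size_sum (\<lambda>s. of_bool (s = k) / real s) n {1..n}"
  let ?C = "\<lambda>G. real (card (trees n G))"
  note fin = finite_set_moran_forest[OF n]
  note [simp] = integrable_measure_pmf_finite[OF fin]
  have "?D = (\<lambda>G. size_sum (\<lambda>s. of_bool (s = k)) n {1..n} G / real k)"
    unfolding size_sum_def sum_divide_distrib by (intro ext sum.cong refl) (auto simp: of_bool_def)
  then have "?E ?D = ?E (size_sum (\<lambda>s. of_bool (s = k)) n {1..n}) / real k" by simp
  then have diff: "pmf (uniform_tree_size n) k - 2 / real k *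
      (?E (size_sum (\<lambda>s. of_bool (s = k)) n {1..n}) / real n) = ?E (\<lambda>G. ?D G / ?C G - 2 / real n * ?D G)"
    using k n by (simp add: pmf_uniform_tree_size)
  have "\<bar>?E (\<lambda>G. ?D G / ?C G - 2 / real n * ?D G)\<bar> \<le> ?E (\<lambda>G. \<bar>?D G / ?C G - 2 / real n * ?D G\<bar>)"
    by (rule integral_abs_bound)
  also have "\<dots> \<le> ?E (\<lambda>G. (4 / (real n * sqrt (real n))) / 2 * (?C G - real n / 2)\<^sup>2 + 1 / (2 * sqrt (real n)))"
  proof (rule expectation_mono_pmf[OF fin])
    fix G
    have C: "?C G > 0" using trees_nonempty[of n G] n by (simp add: card_gt_0_iff)
    have D0: "0 \<le> ?D G" by (simp add: size_sum_def sum_nonneg)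
    have "?D G \<le> ?C G"
      unfolding card_trees_eq size_sum_def by (intro sum_mono) (simp add: of_bool_def)
    then have q: "?D G / ?C G \<le> 1" using C by simp
    define x where "x = 1 - 2 * ?C G / real n"
    have "d / c - 2 / m * d = d / c * (1 - 2 * c / m)" if "c > 0" "m > 0" for c d m :: real
      using that by (simp add: field_simps)
    then have "?D G / ?C G - 2 / real n * ?D G = ?D G / ?C G * x"
      unfolding x_def using C n by simp
    then have "\<bar>?D G / ?C G - 2 / real n * ?D G\<bar> = ?D G / ?C G * \<bar>x\<bar>"
      using D0 C by (simp add: abs_mult)
    also have "\<dots> \<le> \<bar>x\<bar>" using q D0 by (intro mult_left_le_one_le) simp_all
    also have "\<bar>x\<bar> \<le> sqrt (real n) / 2 * x\<^sup>2 + 1 / (2 * sqrt (real n))"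
    proof -
      have s: "sqrt (real n) > 0" using n by simp
      \<comment> \<open>The first moment is bounded by the second through the inequality between arithmetic and
        geometric mean; the weight \<open>sqrt n\<close> balances the two terms, as \<open>x\<^sup>2\<close> has mean at most \<open>1 / n\<close>.\<close>
      have "0 \<le> (sqrt (real n) * \<bar>x\<bar> - 1)\<^sup>2 / (2 * sqrt (real n))" using s by simp
      also have "\<dots> = sqrt (real n) / 2 * x\<^sup>2 + 1 / (2 * sqrt (real n)) - \<bar>x\<bar>"
        using s by (simp add: power2_diff power_mult_distrib field_simps power2_eq_square)
      finally show ?thesis by simp
    qed
    also have "sqrt (real n) / 2 * x\<^sup>2 = (4 / (real n * sqrt (real n))) / 2 * (?C G - real n / 2)\<^sup>2"
    proof -
      have "x = (- 2 / real n) * (?C G - real n / 2)" using n by (simp add: x_def field_simps)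
      then have x2: "x\<^sup>2 = 4 / (real n * real n) * (?C G - real n / 2)\<^sup>2"
        by (simp only: power_mult_distrib) (simp add: power2_eq_square)
      have "sqrt (real n) / 2 * (4 / (real n * real n) * q) = (4 / (real n * sqrt (real n))) / 2 * q" for q
        using n by (simp add: field_simps)
      then show ?thesis unfolding x2 .
    qed
    finally show "\<bar>?D G / ?C G - 2 / real n * ?D G\<bar> \<le>
      (4 / (real n * sqrt (real n))) / 2 * (?C G - real n / 2)\<^sup>2 + 1 / (2 * sqrt (real n))" by simp
  qed
  also have "\<dots> = (4 / (real n * sqrt (real n))) / 2 * ?E (\<lambda>G. (?C G - real n / 2)\<^sup>2) + 1 / (2 * sqrt (real n))"
    by simp
  also have "\<dots> \<le> (4 / (real n * sqrt (real n))) / 2 * (real n / 4) + 1 / (2 * sqrt (real n))"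
    by (intro add_right_mono mult_left_mono second_moment_card_trees n) simp
  also have "\<dots> = 1 / sqrt (real n)" using n by (simp add: field_simps)
  finally show ?thesis unfolding diff .
qed

lemma tendsto_uniform_tree_size:
  assumes k: "k \<ge> 1"
  shows "(\<lambda>n. pmf (uniform_tree_size n) k) \<longlonglongrightarrow> 2 * mixture k"
proof -
  let ?M = "\<lambda>n. 2 / real k *
    (measure_pmf.expectation (moran_forest n) (size_sum (\<lambda>s. of_bool (s = k)) n {1..n}) / real n)"
  have "?M \<longlonglongrightarrow> 2 / real k * (real k * mixture k)"
    by (intro tendsto_mult tendsto_const tendsto_mean_size k)
  then have M: "?M \<longlonglongrightarrow> 2 * mixture k" using k by simp
  have "(\<lambda>n. 1 / sqrt (real n)) \<longlonglongrightarrow> 0" by real_asymp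
  then have "(\<lambda>n. pmf (uniform_tree_size n) k - ?M n) \<longlonglongrightarrow> 0"
    by (rule Lim_null_comparison[rotated])
       (rule eventually_sequentiallyI[of 2], use uniform_tree_size_approx[OF _ k] in simp)
  from tendsto_add[OF this M] show ?thesis by simp
qed

section \<open>The limit laws\<close>

lemma nn_set_integral_continuous:
  fixes h :: "real \<Rightarrow> real"
  assumes "continuous_on {0..1} h" "\<And>x. x \<in> {0..1} \<Longrightarrow> 0 \<le> h x"
  shows "(\<integral>\<^sup>+x. ennreal (h x) * indicator {0..1} x \<partial>lborel) = ennreal (LINT x:{0..1}|lborel. h x)"
proof -
  have "integrable lborel (\<lambda>x. indicator {0..1} x *\<^sub>R h x)"
    using borel_integrable_atLeastAtMost'[OF assms(1)] by (simp add: set_integrable_def)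
  then have "(\<integral>\<^sup>+x. ennreal (indicator {0..1} x *\<^sub>R h x) \<partial>lborel) =
      ennreal (LINT x|lborel. indicator {0..1} x *\<^sub>R h x)"
    using assms(2) by (intro nn_integral_eq_integral) (auto split: split_indicator)
  moreover have "ennreal (indicator {0..1} x *\<^sub>R h x) = ennreal (h x) * indicator {0..1} x" for x
    by (auto split: split_indicator)
  ultimately show ?thesis by (simp add: set_lebesgue_integral_def)
qed

lemma space_X_law: "space X_law = {0..1}"
  by (simp add: X_law_def)

lemma borel_measurable_X_law: "f \<in> borel_measurable borel \<Longrightarrow> f \<in> borel_measurable X_law"
  unfolding X_law_def by (simp add: measurable_restrict_space1)

lemma nn_integral_X_law:
  fixes h :: "real \<Rightarrow> real"
  assumes h: "continuous_on UNIV h" "\<And>x. x \<in> {0..1} \<Longrightarrow> 0 \<le> h x"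
    and f: "\<And>x. x \<in> {0..1} \<Longrightarrow> f x = ennreal (h x)"
  shows "(\<integral>\<^sup>+x. f x \<partial>X_law) = ennreal (LINT x:{0..1}|lborel. 2 * x * h x)"
proof -
  have [measurable]: "h \<in> borel_measurable borel"
    using h(1) by (rule borel_measurable_continuous_onI)
  have "(\<integral>\<^sup>+x. f x \<partial>X_law) = (\<integral>\<^sup>+x. ennreal (h x) \<partial>X_law)"
    by (rule nn_integral_cong) (simp add: space_X_law f)
  also have "\<dots> = (\<integral>\<^sup>+x. ennreal (2 * x) * ennreal (h x) \<partial>restrict_space lborel {0..1})"
    unfolding X_law_def by (rule nn_integral_density) (auto intro!: measurable_restrict_space1)
  also have "\<dots> = (\<integral>\<^sup>+x. ennreal (2 * x) * ennreal (h x) * indicator {0..1} x \<partial>lborel)"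
    by (rule nn_integral_restrict_space) simp
  also have "\<dots> = (\<integral>\<^sup>+x. ennreal (2 * x * h x) * indicator {0..1} x \<partial>lborel)"
    by (intro nn_integral_cong) (auto split: split_indicator simp: ennreal_mult h(2))
  also have "\<dots> = ennreal (LINT x:{0..1}|lborel. 2 * x * h x)"
    using h(2) by (intro nn_set_integral_continuous)
      (auto intro!: continuous_intros continuous_on_subset[OF h(1)])
  finally show ?thesis .
qed

lemma pmf_shifted_geometric:
  assumes "x \<in> {0..1}"
  shows "pmf (map_pmf Suc (geometric_pmf (exp (- x)))) k =
    (if k = 0 then 0 else exp (- x) * (1 - exp (- x)) ^ (k - 1))"
proof (cases k)
  case 0
  have "pmf (map_pmf Suc (geometric_pmf (exp (- x)))) 0 = 0"
    by (subst pmf_eq_0_set_pmf) auto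
  then show ?thesis using 0 by (simp del: pmf_map)
next
  case (Suc j)
  have "pmf (map_pmf Suc (geometric_pmf (exp (- x)))) (Suc j) = pmf (geometric_pmf (exp (- x))) j"
    by (rule pmf_map_inj') simp
  then show ?thesis using Suc assms by (simp add: mult.commute)
qed

lemma measurable_shifted_geometric:
  "(\<lambda>x. measure_pmf (map_pmf Suc (geometric_pmf (exp (- x))))) \<in> measurable X_law (subprob_algebra (count_space UNIV))"
proof (rule measurable_subprob_algebra)
  fix A :: "nat set"
  let ?g = "\<lambda>k x :: real. if k = 0 then 0 else exp (- x) * (1 - exp (- x)) ^ (k - 1)"
  have "emeasure (measure_pmf (map_pmf Suc (geometric_pmf (exp (- x))))) A =
      (\<Sum>k. ennreal (?g k x) * indicator A k)" if "x \<in> space X_law" for x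
  proof -
    let ?p = "map_pmf Suc (geometric_pmf (exp (- x)))"
    have "emeasure (measure_pmf ?p) A = (\<integral>\<^sup>+k. indicator A k \<partial>measure_pmf ?p)"
      by (rule nn_integral_indicator[symmetric]) simp
    also have "\<dots> = (\<integral>\<^sup>+k. ennreal (pmf ?p k) * indicator A k \<partial>count_space UNIV)"
      by (rule nn_integral_measure_pmf)
    also have "\<dots> = (\<Sum>k. ennreal (pmf ?p k) * indicator A k)"
      by (rule nn_integral_count_space_nat)
    finally show ?thesis using that by (simp only: pmf_shifted_geometric space_X_law)
  qed
  moreover have "(\<lambda>x. \<Sum>k. ennreal (?g k x) * indicator A k) \<in> borel_measurable X_law"
    by (rule borel_measurable_X_law) measurable
  ultimately show "(\<lambda>x. emeasure (measure_pmf (map_pmf Suc (geometric_pmf (exp (- x))))) A) \<in> borel_measurable X_law"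
    by (simp cong: measurable_cong)
qed (simp_all add: prob_space_imp_subprob_space prob_space_measure_pmf)

lemma sets_TU_law [simp]: "sets TU_law = UNIV"
proof -
  have "sets TU_law = sets (count_space UNIV :: nat measure)"
    unfolding TU_law_def by (rule sets_bind) (simp_all add: space_X_law)
  then show ?thesis by simp
qed

lemma emeasure_TU_law:
  "emeasure TU_law {k} = ennreal (if k = 0 then 0 else 2 * mixture k)"
proof -
  let ?g = "\<lambda>x :: real. if k = 0 then 0 else exp (- x) * (1 - exp (- x)) ^ (k - 1)"
  have "emeasure TU_law {k} =
      (\<integral>\<^sup>+x. emeasure (measure_pmf (map_pmf Suc (geometric_pmf (exp (- x))))) {k} \<partial>X_law)"
    unfolding TU_law_def
    by (rule emeasure_bind[OF _ measurable_shifted_geometric]) (simp_all add: space_X_law)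
  also have "\<dots> = ennreal (LINT x:{0..1}|lborel. 2 * x * ?g x)"
  proof (rule nn_integral_X_law)
    show "continuous_on UNIV ?g" by (cases "k = 0") (auto intro!: continuous_intros)
  qed (simp_all add: emeasure_pmf_single pmf_shifted_geometric del: pmf_map)
  also have "(LINT x:{0..1}|lborel. 2 * x * ?g x) = (if k = 0 then 0 else 2 * mixture k)"
    by (simp add: mixture_def mult.assoc flip: set_integral_mult_right)
  finally show ?thesis .
qed

lemma mixture_nonneg: "0 \<le> mixture k"
  unfolding mixture_def set_lebesgue_integral_def
  by (intro Bochner_Integration.integral_nonneg) (auto split: split_indicator)

lemma measure_TU_law: "measure TU_law {k} = (if k = 0 then 0 else 2 * mixture k)"
  by (simp add: measure_def emeasure_TU_law mixture_nonneg)

lemma nn_integral_shifted_geometric: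
  assumes "x \<in> {0..1}"
  shows "(\<integral>\<^sup>+j. ennreal (real j) \<partial>measure_pmf (map_pmf Suc (geometric_pmf (exp (- x))))) = ennreal (exp x)"
proof -
  let ?p = "geometric_pmf (exp (- x))"
  have p: "exp (- x) \<in> {0<..1}" using assms by simp
  note [simp] = integrable_real_geometric_pmf[OF p]
  have "(\<integral>\<^sup>+j. ennreal (real j) \<partial>measure_pmf (map_pmf Suc ?p)) = (\<integral>\<^sup>+j. ennreal (real j + 1) \<partial>measure_pmf ?p)"
    by (simp add: add.commute)
  also have "\<dots> = ennreal (measure_pmf.expectation ?p (\<lambda>j. real j + 1))"
    by (rule nn_integral_eq_integral) auto
  also have "measure_pmf.expectation ?p (\<lambda>j. real j + 1) = (1 - exp (- x)) / exp (- x) + 1"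
    by (simp add: expectation_geometric_pmf[OF p])
  also have "\<dots> = exp x" by (simp add: exp_minus field_simps)
  finally show ?thesis .
qed

lemma expectation_TU_law: "(LINT j|TU_law. real j) = 2"
proof -
  have "(\<integral>\<^sup>+j. ennreal (real j) \<partial>TU_law) =
      (\<integral>\<^sup>+x. (\<integral>\<^sup>+j. ennreal (real j) \<partial>measure_pmf (map_pmf Suc (geometric_pmf (exp (- x))))) \<partial>X_law)"
    unfolding TU_law_def by (rule nn_integral_bind[OF _ measurable_shifted_geometric]) simp
  also have "\<dots> = ennreal (LINT x:{0..1}|lborel. 2 * x * exp x)"
    by (rule nn_integral_X_law) (auto intro!: continuous_intros nn_integral_shifted_geometric simp del: nn_integral_map_pmf)
  also have "(LINT x:{0..1}|lborel. 2 * x * exp x :: real) = (\<integral>x. (2 * x * exp x) * indicator {0..1} x \<partial>lborel)"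
    by (simp add: set_lebesgue_integral_def mult.commute)
  also have "\<dots> = (2 * (1 - 1) * exp 1) - (2 * (0 - 1) * exp 0 :: real)"
    by (rule integral_FTC_Icc_real[where F = "\<lambda>x. 2 * (x - 1) * exp x"])
       (auto intro!: derivative_eq_intros continuous_intros simp: algebra_simps)
  finally have "(\<integral>\<^sup>+j. ennreal (real j) \<partial>TU_law) = ennreal 2" by simp
  moreover have "real \<in> borel_measurable TU_law"
    by (simp add: measurable_def)
  ultimately show ?thesis by (simp add: integral_eq_nn_integral)
qed

text \<open>The factor 2 of the point masses of \<open>TU_law\<close> cancels with its mean.\<close>

lemma emeasure_size_biased_TU_law:
  "emeasure (size_biased TU_law) {k} = ennreal (real k * mixture k)"
proof -
  have "emeasure (size_biased TU_law) {k} = ennreal (real k * measure TU_law {k} / 2)"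
    unfolding size_biased_def expectation_TU_law
    by (subst emeasure_density) (simp_all add: nn_integral_count_space_indicator[symmetric])
  then show ?thesis by (simp add: measure_TU_law)
qed

text \<open>The distribution function at \<open>x\<close> is a finite sum of point masses, so it converges at every \<open>x\<close>.\<close>

lemma conv_in_distributionI:
  fixes p :: "nat \<Rightarrow> nat pmf"
  assumes N: "sets N = UNIV" "\<And>k. emeasure N {k} = ennreal (L k)" "\<And>k. L k \<ge> 0"
    and lim: "\<And>k. (\<lambda>n. pmf (p n) k) \<longlonglongrightarrow> L k"
  shows "conv_in_distribution (\<lambda>n. measure_pmf (p n)) N"
proof -
  have cdf: "cdf (distr M borel real) x = (\<Sum>k | real k \<le> x. measure M {k})"
    if M: "sets M = UNIV" "\<And>k. emeasure M {k} \<noteq> \<infinity>" for M x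
  proof -
    have sp: "space M = UNIV" using M(1) sets.top[of M] sets_eq_imp_space_eq[of M "count_space UNIV"] by simp
    have meas: "real \<in> measurable M borel" using M(1) by (simp add: measurable_def sp)
    have fin: "finite {k. real k \<le> x}"
      by (rule finite_subset[of _ "{..nat \<lfloor>x\<rfloor>}"]) (auto simp: le_nat_floor)
    have "cdf (distr M borel real) x = measure M {k. real k \<le> x}"
      unfolding cdf_def by (subst measure_distr[OF meas]) (auto simp: sp vimage_def)
    also have "\<dots> = (\<Sum>k | real k \<le> x. measure M {k})"
      using fin M by (intro measure_eq_sum_singleton) auto
    finally show ?thesis .
  qed
  have "(\<lambda>n. cdf (distr (measure_pmf (p n)) borel real) x) \<longlonglongrightarrow> cdf (distr N borel real) x" for x
  proof -
    have "cdf (distr N borel real) x = (\<Sum>k | real k \<le> x. L k)"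
      using N by (subst cdf) (auto simp: measure_def)
    moreover have "cdf (distr (measure_pmf (p n)) borel real) x = (\<Sum>k | real k \<le> x. pmf (p n) k)" for n
      by (subst cdf) (auto simp: emeasure_pmf_single pmf.rep_eq)
    ultimately show ?thesis by (simp add: tendsto_sum lim)
  qed
  then show ?thesis by (simp add: conv_in_distribution_def weak_conv_m_def weak_conv_def)
qed

lemma pmf_tree_size_0:
  assumes "n \<ge> 2"
  shows "pmf (uniform_tree_size n) 0 = 0" "pmf (vertex1_tree_size n) 0 = 0"
proof -
  have "size_sum (\<lambda>s. of_bool (s = 0) / real s) n {1..n} G = 0" for G
    unfolding size_sum_def by (intro sum.neutral) simp
  then show "pmf (uniform_tree_size n) 0 = 0" using assms by (simp add: pmf_uniform_tree_size)
  show "pmf (vertex1_tree_size n) 0 = 0"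
    unfolding pmf_vertex1_tree_size[OF assms] expectation_size_moran_forest[OF assms] by simp
qed

theorem theorem5p5:
  shows
    "(\<forall>k\<ge>1. (\<lambda>n. pmf (uniform_tree_size n) k)
        \<longlonglongrightarrow> 2 * (LINT x:{0..1}|lborel. x * exp (- x) * (1 - exp (- x)) ^ (k - 1)))
     \<and> conv_in_distribution (\<lambda>n. measure_pmf (uniform_tree_size n)) TU_law
     \<and> (\<forall>k\<ge>1. (\<lambda>n. pmf (vertex1_tree_size n) k)
        \<longlonglongrightarrow> real k * (LINT x:{0..1}|lborel. x * exp (- x) * (1 - exp (- x)) ^ (k - 1)))
     \<and> conv_in_distribution (\<lambda>n. measure_pmf (vertex1_tree_size n)) (size_biased TU_law)"
proof (intro conjI)
  show "\<forall>k\<ge>1. (\<lambda>n. pmf (uniform_tree_size n) k)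
        \<longlonglongrightarrow> 2 * (LINT x:{0..1}|lborel. x * exp (- x) * (1 - exp (- x)) ^ (k - 1))"
    using tendsto_uniform_tree_size unfolding mixture_def by blast
  show "\<forall>k\<ge>1. (\<lambda>n. pmf (vertex1_tree_size n) k)
        \<longlonglongrightarrow> real k * (LINT x:{0..1}|lborel. x * exp (- x) * (1 - exp (- x)) ^ (k - 1))"
    using tendsto_vertex1_tree_size unfolding mixture_def by blast
  have ev0: "(\<lambda>n. pmf (p n) 0) \<longlonglongrightarrow> 0" if "\<And>n. n \<ge> 2 \<Longrightarrow> pmf (p n) 0 = 0" for p :: "nat \<Rightarrow> nat pmf"
    by (rule tendsto_eventually, rule eventually_sequentiallyI[of 2], rule that)
  show "conv_in_distribution (\<lambda>n. measure_pmf (uniform_tree_size n)) TU_law"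
  proof (rule conv_in_distributionI[OF sets_TU_law emeasure_TU_law])
    show "(\<lambda>n. pmf (uniform_tree_size n) k) \<longlonglongrightarrow> (if k = 0 then 0 else 2 * mixture k)" for k
      using tendsto_uniform_tree_size[of k] ev0[OF pmf_tree_size_0(1)] by (cases "k = 0") auto
  qed (simp add: mixture_nonneg)
  show "conv_in_distribution (\<lambda>n. measure_pmf (vertex1_tree_size n)) (size_biased TU_law)"
  proof (rule conv_in_distributionI[OF _ emeasure_size_biased_TU_law])
    show "(\<lambda>n. pmf (vertex1_tree_size n) k) \<longlonglongrightarrow> real k * mixture k" for k
      using tendsto_vertex1_tree_size[of k] ev0[OF pmf_tree_size_0(2)] by (cases "k = 0") auto
  qed (simp_all add: size_biased_def mixture_nonneg)
qed

end
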